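(* Let $g:\mathbb{R}^d\to\mathbb{R}$ satisfy: (g-i) $g$ is continuously differentiable and non-negative; (g-ii) $\|\nabla g(\theta)-\nabla g(\theta')\|\le L\|\theta-\theta'\|$ for all $\theta,\theta'\in\mathbb{R}^d$; (g-iii) there exists $\eta>0$ such that $\liminf_{\|\theta\|\to+\infty}\|\nabla g(\theta)\|^2>\eta$; (g-iv) $g$ is coercive: $\lim_{\|\theta\|\to+\infty}g(\theta)=+\infty$. Let $\{\theta_n\}_{n\ge1}$ be generated by AdaGrad-Norm, and suppose that for all $n\ge 1$: (n-i) $\mathbb{E}[\nabla g(\theta_n,\xi_n)\mid\mathscr{F}_{n-1}]=\nabla g(\theta_n)$; (n-ii) $\mathbb{E}[\|\nabla g(\theta_n,\xi_n)\|^2\mid\mathscr{F}_{n-1}]\le\sigma_0\|\nabla g(\theta_n)\|^2+\sigma_1$ for some constants $\sigma_0,\sigma_1\ge0$; (n-iii) for some constants $D_0,D_1>0$, for any $\theta_n$ satisfying $\|\nabla g(\theta_n)\|^2<D_0$ one has $\|\nabla g(\theta_n,\xi_n)\|^2<D_1$ almost surely. Then $$\sup_{n\ge1}\|\theta_n\|<+\infty\quad\text{almost surely.}$$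
   Context: AdaGrad-Norm: given an initial point $\theta_1\in\mathbb{R}^d$ and constants $S_0>0$, $\alpha_0>0$, for $n\ge1$ $$S_n=S_{n-1}+\|\nabla g(\theta_n,\xi_n)\|^2,\qquad \theta_{n+1}=\theta_n-\frac{\alpha_0}{\sqrt{S_n}}\nabla g(\theta_n,\xi_n).$$ Here $\{\xi_n\}_{n\ge1}$ is a sequence of independent random variables and $\nabla g(\theta_n,\xi_n)\in\mathbb{R}^d$ is the random vector (stochastic gradient) returned by a stochastic first-order oracle at $\theta_n$ with noise $\xi_n$. The filtration is $\mathscr{F}_n=\sigma\{\theta_1,\xi_1,\dots,\xi_n\}$ for $n\ge1$ and $\mathscr{F}_0=\{\emptyset,\Omega\}$. *)

theory Defs
  imports "HOL-Probability.Probability"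
begin

(* The generating set contains the events of the initial point theta 1 as well; at n = 0 the
   sigma-algebra is trivial by definition. The index 0 of theta and xi is never used. *)
definition adagrad_filtration ::
  "'w measure \<Rightarrow> 'x measure \<Rightarrow> (nat \<Rightarrow> 'w \<Rightarrow> real ^ 'd) \<Rightarrow> (nat \<Rightarrow> 'w \<Rightarrow> 'x) \<Rightarrow> nat \<Rightarrow> 'w measure"
where
  "adagrad_filtration M N \<theta> \<xi> n =
     (if n = 0 then sigma (space M) {}
      else sigma (space M)
        ({\<theta> 1 -` A \<inter> space M | A. A \<in> sets borel} \<union>
         (\<Union>i\<in>{1..n}. {\<xi> i -` A \<inter> space M | A. A \<in> sets N})))"

(* G x z is the answer of the stochastic first-order oracle at the point x with noise z. *)
definition adagrad_norm ::
  "'w measure \<Rightarrow> (real ^ 'd \<Rightarrow> 'x \<Rightarrow> real ^ 'd) \<Rightarrow> (nat \<Rightarrow> 'w \<Rightarrow> 'x) \<Rightarrow> real ^ 'd \<Rightarrow> real \<Rightarrow> real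
    \<Rightarrow> (nat \<Rightarrow> 'w \<Rightarrow> real ^ 'd) \<Rightarrow> (nat \<Rightarrow> 'w \<Rightarrow> real) \<Rightarrow> bool"
where
  "adagrad_norm M G \<xi> x1 S0 \<alpha>0 \<theta> S \<longleftrightarrow>
     (\<forall>\<omega>\<in>space M.
        \<theta> 1 \<omega> = x1 \<and> S 0 \<omega> = S0 \<and>
        (\<forall>n\<ge>1. S n \<omega> = S (n - 1) \<omega> + (norm (G (\<theta> n \<omega>) (\<xi> n \<omega>)))\<^sup>2 \<and>
               \<theta> (n + 1) \<omega> = \<theta> n \<omega> - (\<alpha>0 / sqrt (S n \<omega>)) *\<^sub>R G (\<theta> n \<omega>) (\<xi> n \<omega>)))"

(* Conditional expectation of a random vector, taken coordinatewise. Integrability of X is not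
   part of the definition. For the oracle answers it follows from the conditional second
   moment bound, since norm (theta (n + 1) - theta n) <= alpha0 and theta 1 is deterministic. *)
definition is_vec_cond_exp ::
  "'w measure \<Rightarrow> 'w measure \<Rightarrow> ('w \<Rightarrow> real ^ 'd) \<Rightarrow> ('w \<Rightarrow> real ^ 'd) \<Rightarrow> bool"
where
  "is_vec_cond_exp M F X Y \<longleftrightarrow>
     (\<forall>i. AE \<omega> in M. real_cond_exp M F (\<lambda>\<omega>. X \<omega> $ i) \<omega> = Y \<omega> $ i)"

lemma subalgebra_adagrad_filtration:
  assumes "\<And>i. i \<ge> 1 \<Longrightarrow> \<xi> i \<in> M \<rightarrow>\<^sub>M N" and "\<theta> 1 \<in> borel_measurable M"
  shows "subalgebra M (adagrad_filtration M N \<theta> \<xi> n)"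
proof (cases "n = 0")
  case True
  then show ?thesis
    by (simp add: adagrad_filtration_def subalgebra_def space_measure_of_conv sets.sigma_sets_subset)
next
  case False
  let ?A = "{\<theta> 1 -` A \<inter> space M | A. A \<in> sets borel} \<union>
         (\<Union>i\<in>{1..n}. {\<xi> i -` A \<inter> space M | A. A \<in> sets N})"
  have sub: "?A \<subseteq> sets M"
    using assms by (auto intro: measurable_sets)
  then have "?A \<subseteq> Pow (space M)"
    using sets.space_closed by blast
  then show ?thesis
    using False sub
    by (simp add: adagrad_filtration_def subalgebra_def space_measure_of_conv sets.sigma_sets_subset)
qed

end

theory Submission
  imports Defs
begin

text \<open>
  Let \<open>x\<close> be the current iterate, \<open>\<gamma>\<close> the stochastic gradient at \<open>x\<close>, and \<open>s\<close>, \<open>s' = s + \<parallel>\<gamma>\<parallel>\<^sup>2\<close> the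
  accumulated squared norms before and after it is drawn, so that the step is
  \<open>- (\<alpha> / sqrt s') \<gamma>\<close>. Descent along a smooth function costs a second-order term of size
  \<open>\<parallel>\<gamma>\<parallel>\<^sup>2 / s'\<close>, whose sum over all steps may grow like the logarithm of \<open>s\<close>. Boundedness therefore
  cannot be read off from \<open>g\<close> itself. It follows from two facts.

  First, the weighted gradients \<open>\<parallel>D x\<parallel>\<^sup>2 / s\<close> have a finite expected sum over all steps
  (\<open>sum_expectation_scaled_gradient_le\<close>). Dividing \<open>g\<close> by \<open>sqrt s\<close> improves the second-order cost
  to \<open>\<parallel>\<gamma>\<parallel>\<^sup>2 / (s' sqrt s')\<close>, which telescopes. The step size depends on \<open>\<gamma>\<close>; replacing
  it by a predictable one produces an error that is controlled by a fraction of \<open>\<parallel>D x\<parallel>\<^sup>2 / s\<close> and by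
  \<open>(\<sigma>0 \<parallel>D x\<parallel>\<^sup>2 + \<sigma>1) (1 / s - 1 / s')\<close>. The latter telescopes as well, up to the change of the
  gradient along the step. The function
  \<open>weighted_energy\<close> collects the potentials of all the telescoping terms
  (\<open>weighted_energy_step\<close>).

  Second, there is a function of the iterate that changes only where the gradient is not small.
  The squared gradient exceeds \<open>\<eta>\<close> outside a bounded set, and no step is longer than \<open>\<alpha>\<close>, so a
  step from a point with squared gradient below \<open>\<eta>\<close> stays in a fixed bounded set \<open>K\<close>. Choose \<open>b\<close>
  above \<open>ln (1 + g)\<close> on \<open>K\<close> and let \<open>V\<close> be the square of the positive part of \<open>ln (1 + g) - b\<close>.
  Then \<open>V\<close> stays zero in those steps. In all other steps
  \<open>\<sigma>0 \<parallel>D x\<parallel>\<^sup>2 + \<sigma>1 \<le> (\<sigma>0 + \<sigma>1 / \<eta>) \<parallel>D x\<parallel>\<^sup>2\<close>, so the expected cost \<open>\<parallel>\<gamma>\<parallel>\<^sup>2 / s\<close> is at most a constant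
  times the expected \<open>\<parallel>D x\<parallel>\<^sup>2 / s\<close>, and the first fact makes it summable. The logarithm is there to
  make the gradient of \<open>V\<close> bounded, since \<open>\<parallel>D x\<parallel>\<close> is at most of order \<open>sqrt (g x)\<close>; then the
  error from the predictable step size has the same order \<open>\<parallel>\<gamma>\<parallel>\<^sup>2 / s\<close> (\<open>log_excess_square_step\<close>).

  Hence \<open>V\<close> along the iterates is a non-negative supermartingale up to a summable drift. Doob's
  maximal inequality (\<open>maximal_inequality\<close>) shows that its supremum is almost surely finite,
  and coercivity of \<open>g\<close> carries this over to the iterates.
\<close>
section \<open>Smooth non-negative functions and the logarithm of their values\<close>

lemma smooth_upper_bound:
  fixes g :: "'a::real_inner \<Rightarrow> real"
  assumes grad: "\<And>x. GDERIV g x :> D x"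
    and lip: "\<And>x y. norm (D x - D y) \<le> L * norm (x - y)"
  shows "g y \<le> g x + D x \<bullet> (y - x) + L / 2 * (norm (y - x))\<^sup>2"
proof -
  let ?d = "y - x"
  define f where "f t = g (x + t *\<^sub>R ?d) - t * (D x \<bullet> ?d) - L / 2 * t\<^sup>2 * (norm ?d)\<^sup>2" for t
  have der: "(f has_real_derivative
      ((D (x + t *\<^sub>R ?d) - D x) \<bullet> ?d - L * t * (norm ?d)\<^sup>2)) (at t)" for t
  proof -
    have "(g has_derivative (\<lambda>h. h \<bullet> D (x + t *\<^sub>R ?d))) (at (x + t *\<^sub>R ?d))"
      using grad by (simp add: gderiv_def)
    moreover have "((\<lambda>t. x + t *\<^sub>R ?d) has_derivative (\<lambda>h. h *\<^sub>R ?d)) (at t)"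
      by (auto intro!: derivative_eq_intros)
    ultimately have "((\<lambda>t. g (x + t *\<^sub>R ?d)) has_derivative
        (\<lambda>h. (h *\<^sub>R ?d) \<bullet> D (x + t *\<^sub>R ?d))) (at t)"
      by (rule has_derivative_compose[rotated])
    then have "((\<lambda>t. g (x + t *\<^sub>R ?d)) has_real_derivative (D (x + t *\<^sub>R ?d) \<bullet> ?d)) (at t)"
      by (simp add: has_field_derivative_def inner_commute mult_commute_abs)
    then show ?thesis
      unfolding f_def
      by (auto intro!: derivative_eq_intros simp: inner_diff_left power2_eq_square)
  qed
  have "f 1 \<le> f 0"
  proof (rule DERIV_nonpos_imp_nonincreasing[where f = f and a = 0 and b = 1])
    fix t :: real assume t: "0 \<le> t" "t \<le> 1"
    have "(D (x + t *\<^sub>R ?d) - D x) \<bullet> ?d \<le> norm (D (x + t *\<^sub>R ?d) - D x) * norm ?d"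
      by (rule norm_cauchy_schwarz)
    also have "\<dots> \<le> (L * norm (t *\<^sub>R ?d)) * norm ?d"
      using lip[of "x + t *\<^sub>R ?d" x] by (intro mult_right_mono) auto
    also have "\<dots> = L * t * (norm ?d)\<^sup>2"
      using t by (simp add: power2_eq_square)
    finally show "\<exists>z. (f has_real_derivative z) (at t) \<and> z \<le> 0"
      using der[of t] by force
  qed simp
  then show ?thesis by (simp add: f_def)
qed

text \<open>A gradient step of length \<open>1 / L\<close> lowers \<open>g\<close> by at least \<open>\<parallel>D x\<parallel>\<^sup>2 / (2 L)\<close>, and it cannot go below
  zero.\<close>
lemma norm_gradient_le_sqrt_value:
  fixes g :: "'a::real_inner \<Rightarrow> real"
  assumes grad: "\<And>x. GDERIV g x :> D x"
    and lip: "\<And>x y. norm (D x - D y) \<le> L * norm (x - y)"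
    and nonneg: "\<And>x. g x \<ge> 0" and L: "L > 0"
  shows "norm (D x) \<le> sqrt (2 * L) * sqrt (g x)"
proof -
  have "0 \<le> g (x - (1 / L) *\<^sub>R D x)" by (rule nonneg)
  also have "\<dots> \<le> g x - (norm (D x))\<^sup>2 / L + L / 2 * ((norm (D x))\<^sup>2 / L\<^sup>2)"
    using smooth_upper_bound[OF grad lip, of "x - (1 / L) *\<^sub>R D x" x]
    by (simp add: power_divide dot_square_norm)
  also have "\<dots> = g x - (norm (D x))\<^sup>2 / (2 * L)"
    using L by (simp add: field_simps power2_eq_square)
  finally have "(norm (D x))\<^sup>2 \<le> 2 * L * g x"
    using L by (simp add: field_simps)
  then show ?thesis
    using real_le_rsqrt by (fastforce simp: real_sqrt_mult)
qed

text \<open>The excess is used through its square, which is differentiable at the threshold as well.\<close>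
definition log_excess :: "real \<Rightarrow> real \<Rightarrow> real" where
  "log_excess b t = max 0 (ln (1 + t) - b)"

lemma log_excess_nonneg [simp]: "log_excess b t \<ge> 0"
  by (simp add: log_excess_def)

lemma log_excess_le_ln: "b \<ge> 0 \<Longrightarrow> t \<ge> 0 \<Longrightarrow> log_excess b t \<le> ln (1 + t)"
  by (simp add: log_excess_def)

text \<open>The squared positive part is bounded by its quadratic expansion with curvature one. The linear
  term is turned into one in \<open>g\<close> by concavity of the logarithm, and the quadratic one into
  \<open>\<parallel>y - x\<parallel>\<^sup>2\<close> because \<open>ln (1 + g)\<close> is Lipschitz. The coefficient of the inner product is the
  derivative of the squared excess with respect to the value of \<open>g\<close>.\<close>
lemma log_excess_square_upper_bound:
  fixes g :: "'a::real_inner \<Rightarrow> real"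
  assumes grad: "\<And>x. GDERIV g x :> D x"
    and lip: "\<And>x y. norm (D x - D y) \<le> L * norm (x - y)"
    and nonneg: "\<And>x. g x \<ge> 0" and L: "L > 0" and b: "b \<ge> 0"
  shows "(log_excess b (g y))\<^sup>2 \<le> (log_excess b (g x))\<^sup>2
    + 2 * log_excess b (g x) / (1 + g x) * (D x \<bullet> (y - x)) + 3 * L * (norm (y - x))\<^sup>2"
proof -
  define u v p where "u = ln (1 + g x)" and "v = ln (1 + g y)" and "p = log_excess b (g x)"
  have gx: "1 + g x > 0" and gy: "1 + g y > 0"
    using nonneg[of x] nonneg[of y] by auto
  have "(log_excess b (g y))\<^sup>2 \<le> p\<^sup>2 + 2 * p * (v - u) + (v - u)\<^sup>2"
  proof (cases "u \<le> b")
    case True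
    then have "\<bar>max 0 (v - b)\<bar> \<le> \<bar>v - u\<bar>" by auto
    then have "(max 0 (v - b))\<^sup>2 \<le> (v - u)\<^sup>2" by (rule abs_le_square_iff[THEN iffD1])
    with True show ?thesis by (simp add: p_def log_excess_def u_def v_def)
  next
    case False
    have "p\<^sup>2 + 2 * p * (v - u) + (v - u)\<^sup>2 = (p + (v - u))\<^sup>2"
      by (simp add: power2_eq_square algebra_simps)
    also have "p + (v - u) = v - b"
      using False by (simp add: p_def log_excess_def u_def)
    finally show ?thesis
      by (auto simp: log_excess_def v_def max_def)
  qed
  moreover have "2 * p * (v - u) \<le> 2 * p / (1 + g x) * (D x \<bullet> (y - x)) + L * (norm (y - x))\<^sup>2"
  proof -
    have "v - u = ln ((1 + g y) / (1 + g x))"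
      using gx gy by (simp add: u_def v_def ln_div)
    also have "\<dots> \<le> (1 + g y) / (1 + g x) - 1"
      using gx gy by (intro ln_le_minus_one) simp
    also have "\<dots> = (g y - g x) / (1 + g x)"
      using gx by (simp add: field_simps)
    also have "\<dots> \<le> (D x \<bullet> (y - x) + L / 2 * (norm (y - x))\<^sup>2) / (1 + g x)"
      using gx smooth_upper_bound[OF grad lip, of y x] by (intro divide_right_mono) auto
    finally have "2 * p * (v - u)
        \<le> 2 * p * ((D x \<bullet> (y - x) + L / 2 * (norm (y - x))\<^sup>2) / (1 + g x))"
      by (intro mult_left_mono) (auto simp: p_def)
    also have "\<dots> = 2 * p / (1 + g x) * (D x \<bullet> (y - x)) + p / (1 + g x) * (L * (norm (y - x))\<^sup>2)"
    proof -
      have "2 * p * ((X + L / 2 * Y) / c) = 2 * p / c * X + p / c * (L * Y)" if "c > 0" for X Y c :: real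
        using that by (simp add: field_simps)
      then show ?thesis using gx by blast
    qed
    also have "p / (1 + g x) \<le> 1"
      using log_excess_le_ln[OF b nonneg, of x] ln_le_minus_one[OF gx] gx
      by (simp add: p_def)
    then have "p / (1 + g x) * (L * (norm (y - x))\<^sup>2) \<le> L * (norm (y - x))\<^sup>2"
      using L by (intro mult_left_le_one_le) (auto simp: p_def nonneg)
    finally show ?thesis by simp
  qed
  moreover have "(v - u)\<^sup>2 \<le> 2 * L * (norm (y - x))\<^sup>2"
  proof -
    have "norm (ln (1 + g y) - ln (1 + g x)) \<le> sqrt (2 * L) * norm (y - x)"
    proof (rule differentiable_bound[where S = UNIV])
      fix z :: 'a
      have z: "1 + g z > 0" using nonneg[of z] by simp
      have "(g has_derivative (\<lambda>h. h \<bullet> D z)) (at z)"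
        using grad by (simp add: gderiv_def)
      then show "((\<lambda>z. ln (1 + g z)) has_derivative (\<lambda>h. h \<bullet> D z / (1 + g z))) (at z)"
        using z by (auto intro!: derivative_eq_intros simp: field_simps)
      have "norm (D z) / (1 + g z) \<le> sqrt (2 * L)"
      proof -
        have "sqrt (g z) \<le> 1 + g z"
          using nonneg[of z] by (intro real_le_lsqrt) (auto simp: power2_eq_square algebra_simps)
        then have "sqrt (2 * L) * sqrt (g z) \<le> sqrt (2 * L) * (1 + g z)"
          using L by (intro mult_left_mono) auto
        then show ?thesis
          using norm_gradient_le_sqrt_value[OF grad lip nonneg L, of z] z by (simp add: field_simps)
      qed
      moreover have "\<bar>h \<bullet> D z / (1 + g z)\<bar> \<le> norm (D z) / (1 + g z) * norm h" for h
        using z Cauchy_Schwarz_ineq2[of h "D z"] by (simp add: divide_right_mono mult.commute)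
      ultimately have "\<bar>h \<bullet> D z / (1 + g z)\<bar> \<le> sqrt (2 * L) * norm h" for h
        by (meson mult_right_mono norm_ge_zero order_trans)
      then show "onorm (\<lambda>h. h \<bullet> D z / (1 + g z)) \<le> sqrt (2 * L)"
        using L by (intro onorm_bound) auto
    qed auto
    then have "(norm (ln (1 + g y) - ln (1 + g x)))\<^sup>2 \<le> (sqrt (2 * L) * norm (y - x))\<^sup>2"
      by (rule power_mono) simp
    then show ?thesis
      using L by (simp add: u_def v_def power_mult_distrib)
  qed
  ultimately show ?thesis
    unfolding p_def by linarith
qed

text \<open>The logarithm of \<open>1 + g x\<close> and the gradient of \<open>g\<close> are both at most of order \<open>sqrt (1 + g x)\<close>, so
  the denominator outweighs their product.\<close>
lemma log_excess_square_gradient_bound: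
  fixes g :: "'a::real_inner \<Rightarrow> real"
  assumes grad: "\<And>x. GDERIV g x :> D x"
    and lip: "\<And>x y. norm (D x - D y) \<le> L * norm (x - y)"
    and nonneg: "\<And>x. g x \<ge> 0" and L: "L > 0" and b: "b \<ge> 0"
  shows "2 * log_excess b (g x) / (1 + g x) * norm (D x) \<le> 4 * sqrt (2 * L)"
proof -
  define r where "r = sqrt (1 + g x)"
  have r: "r > 0" "r\<^sup>2 = 1 + g x"
    using nonneg[of x] by (simp_all add: r_def add_pos_nonneg)
  have "ln (1 + g x) = 2 * ln r"
    using r ln_realpow[of r 2] by simp
  then have "log_excess b (g x) \<le> 2 * r"
    using log_excess_le_ln[OF b nonneg, of x] ln_le_minus_one[OF r(1)] by simp
  moreover have "norm (D x) \<le> sqrt (2 * L) * r"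
  proof -
    have "sqrt (2 * L) * sqrt (g x) \<le> sqrt (2 * L) * r"
      using L by (intro mult_left_mono) (auto simp: r_def)
    then show ?thesis
      using norm_gradient_le_sqrt_value[OF grad lip nonneg L, of x] by simp
  qed
  ultimately have "log_excess b (g x) * norm (D x) \<le> (2 * r) * (sqrt (2 * L) * r)"
    using r by (intro mult_mono) auto
  also have "\<dots> = 2 * sqrt (2 * L) * r\<^sup>2" by (simp add: power2_eq_square)
  finally have *: "log_excess b (g x) * norm (D x) \<le> 2 * sqrt (2 * L) * (1 + g x)" using r by simp
  have "2 * log_excess b (g x) / (1 + g x) * norm (D x)
      = 2 * (log_excess b (g x) * norm (D x)) / (1 + g x)" by simp
  also have "\<dots> \<le> 2 * (2 * sqrt (2 * L) * (1 + g x)) / (1 + g x)"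
    using * nonneg[of x] by (intro divide_right_mono mult_left_mono) auto
  also have "\<dots> = 4 * sqrt (2 * L)" using nonneg[of x] by (simp add: add_nonneg_eq_0_iff)
  finally show ?thesis .
qed

text \<open>Here \<open>q\<close> plays the role of the squared norm of the stochastic gradient. The first inequality makes
  the second-order cost of the weighted energy telescope; the second bounds the error of replacing
  the step size by the one before the gradient is drawn.\<close>
lemma inverse_sqrt_decrement:
  fixes s q :: real
  assumes "s > 0" "q \<ge> 0"
  shows "q / (s + q) / sqrt (s + q) \<le> 2 * (1 / sqrt s - 1 / sqrt (s + q))"
    and "sqrt q * (1 / sqrt s - 1 / sqrt (s + q)) \<le> q / s"
proof -
  define a c where "a = sqrt s" and "c = sqrt (s + q)"
  have a: "a > 0" "c \<ge> a" "c > 0" and s: "s = a\<^sup>2" and c2: "c\<^sup>2 = s + q"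
    using assms by (auto simp: a_def c_def)
  have q: "q = (c - a) * (c + a)"
    using s c2 by (simp add: power2_eq_square algebra_simps)
  have "q / (s + q) / c = (c - a) * (c + a) / (c\<^sup>2 * c)"
    using c2 q by simp
  also have "\<dots> \<le> (c - a) * (2 * c) / (c\<^sup>2 * c)"
    using a by (intro divide_right_mono mult_left_mono) auto
  also have "\<dots> = 2 * ((c - a) / (c * c))"
    using a by (simp add: field_simps power2_eq_square)
  also have "\<dots> \<le> 2 * ((c - a) / (a * c))"
    using a by (intro mult_left_mono divide_left_mono mult_right_mono) auto
  also have "(c - a) / (a * c) = 1 / a - 1 / c"
    using a by (simp add: field_simps)
  finally show "q / (s + q) / sqrt (s + q) \<le> 2 * (1 / sqrt s - 1 / sqrt (s + q))"
    by (simp add: a_def c_def)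
  have "sqrt q \<le> c" using assms by (simp add: c_def)
  then have "sqrt q * (1 / a - 1 / c) \<le> c * (1 / a - 1 / c)"
    using a by (intro mult_right_mono) (auto simp: frac_le)
  also have "\<dots> = (c - a) / a" using a by (simp add: field_simps)
  also have "\<dots> \<le> (c - a) / a * ((c + a) / a)"
  proof -
    have "(c - a) / a * 1 \<le> (c - a) / a * ((c + a) / a)"
      using a by (intro mult_left_mono) auto
    then show ?thesis by simp
  qed
  also have "\<dots> = q / s" using q s by (simp add: power2_eq_square)
  finally show "sqrt q * (1 / sqrt s - 1 / sqrt (s + q)) \<le> q / s"
    by (simp add: a_def c_def)
qed

text \<open>Besides \<open>g\<close> weighted by \<open>1 / sqrt s\<close> there are three potentials, each paying for one error in
  a step: \<open>L \<alpha>\<^sup>2 / sqrt s\<close> for the second-order cost, \<open>\<alpha>\<close> times the second-moment bound over \<open>s\<close> for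
  the dependence of the step size on the current stochastic gradient, and the last constant over
  \<open>s\<close> for the change of that moment bound from one iterate to the next.\<close>
definition weighted_energy ::
  "('a::real_inner \<Rightarrow> real) \<Rightarrow> ('a \<Rightarrow> 'a) \<Rightarrow> real \<Rightarrow> real \<Rightarrow> real \<Rightarrow> real \<Rightarrow> 'a \<Rightarrow> real \<Rightarrow> real" where
  "weighted_energy g D L \<alpha> \<sigma>0 \<sigma>1 x s =
     (g x + L * \<alpha>\<^sup>2) / sqrt s
     + (\<alpha> * (\<sigma>0 * (norm (D x))\<^sup>2 + \<sigma>1) + \<alpha> ^ 3 * L\<^sup>2 * \<sigma>0 * (5 + 4 * \<sigma>0)) / s"

text \<open>Two quarters of \<open>\<alpha> \<parallel>D x\<parallel>\<^sup>2 / s\<close> appear on the right: one openly, the other in expectation, since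
  the squared norm of \<open>\<gamma>\<close> is divided by its conditional second-moment bound. The term
  \<open>\<alpha> (D x \<bullet> \<gamma>) / s\<close> has conditional expectation \<open>\<alpha> \<parallel>D x\<parallel>\<^sup>2 / s\<close>, so half of it survives as a decrease.
  All weights multiplying \<open>\<gamma>\<close> depend only on \<open>x\<close> and \<open>s\<close>, which makes them predictable.\<close>
lemma weighted_energy_step:
  fixes g :: "'a::real_inner \<Rightarrow> real"
  assumes grad: "\<And>x. GDERIV g x :> D x"
    and lip: "\<And>x y. norm (D x - D y) \<le> L * norm (x - y)"
    and nonneg: "\<And>x. g x \<ge> 0" and L: "L > 0"
    and \<alpha>: "\<alpha> > 0" and \<sigma>0: "\<sigma>0 \<ge> 0" and \<sigma>1: "\<sigma>1 > 0"
    and s: "s > 0" and s': "s' = s + (norm \<gamma>)\<^sup>2" and x': "x' = x - (\<alpha> / sqrt s') *\<^sub>R \<gamma>"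
  shows "weighted_energy g D L \<alpha> \<sigma>0 \<sigma>1 x' s' + \<alpha> * (D x \<bullet> \<gamma>) / s \<le>
    weighted_energy g D L \<alpha> \<sigma>0 \<sigma>1 x s
    + \<alpha> / 4 * ((norm (D x))\<^sup>2 / ((\<sigma>0 * (norm (D x))\<^sup>2 + \<sigma>1) * s) * (norm \<gamma>)\<^sup>2)
    + \<alpha> / 4 * ((norm (D x))\<^sup>2 / s)"
proof -
  define c d Q Q' p where "c = norm \<gamma>" and "d = norm (D x)"
    and "Q = \<sigma>0 * (norm (D x))\<^sup>2 + \<sigma>1" and "Q' = \<sigma>0 * (norm (D x'))\<^sup>2 + \<sigma>1"
    and "p = (norm \<gamma>)\<^sup>2 / s'"
  have s'pos: "s' > 0" and ss': "s \<le> s'" using s s' by (auto intro: add_pos_nonneg)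
  have Q: "Q > 0" using \<sigma>0 \<sigma>1 by (simp add: Q_def add_nonneg_pos)
  have p: "0 \<le> p" "p \<le> 1" using s s' s'pos by (auto simp: p_def)
  have nonneg': "c \<ge> 0" "d \<ge> 0" by (simp_all add: c_def d_def)
  have ps: "p / s = 1 / s - 1 / s'"
    using s s'pos by (simp add: p_def s' field_simps)
  have step: "norm (x' - x) = \<alpha> * (c / sqrt s')"
    using \<alpha> s'pos by (simp add: x' c_def)
  have step2: "(norm (x' - x))\<^sup>2 = \<alpha>\<^sup>2 * p"
    unfolding step using s'pos by (simp add: power_mult_distrib power_divide p_def c_def)

  \<comment> \<open>Non-negativity of \<open>g\<close> allows the weight of the old value to be raised back to \<open>1 / sqrt s\<close>.\<close>
  have 1: "g x' / sqrt s' \<le> g x / sqrt s - \<alpha> * (D x \<bullet> \<gamma>) / s' + L * \<alpha>\<^sup>2 * (1 / sqrt s - 1 / sqrt s')"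
  proof -
    have "g x' / sqrt s' \<le> (g x + D x \<bullet> (x' - x) + L / 2 * (norm (x' - x))\<^sup>2) / sqrt s'"
      using smooth_upper_bound[OF grad lip] s'pos by (intro divide_right_mono) auto
    also have "\<dots> = g x / sqrt s' - \<alpha> * (D x \<bullet> \<gamma>) / (sqrt s' * sqrt s') + L / 2 * \<alpha>\<^sup>2 * (p / sqrt s')"
      unfolding step2 by (simp add: x' add_divide_distrib diff_divide_distrib)
    also have "sqrt s' * sqrt s' = s'" using s'pos by simp
    also have "g x / sqrt s' \<le> g x / sqrt s"
      using ss' s nonneg by (intro divide_left_mono) auto
    also have "L / 2 * \<alpha>\<^sup>2 * (p / sqrt s') \<le> L / 2 * \<alpha>\<^sup>2 * (2 * (1 / sqrt s - 1 / sqrt s'))"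
      using L inverse_sqrt_decrement(1)[OF s, of "(norm \<gamma>)\<^sup>2"]
      by (intro mult_left_mono) (auto simp: p_def s')
    finally show ?thesis by (simp add: right_diff_distrib diff_divide_distrib)
  qed
  \<comment> \<open>Replacing \<open>1 / s'\<close> by \<open>1 / s\<close> costs \<open>\<parallel>D x\<parallel> \<parallel>\<gamma>\<parallel> p / s\<close>. The inequality between the arithmetic and
    the geometric mean, weighted by \<open>Q\<close>, splits it into a term with predictable weight and
    \<open>Q p / s\<close>, a difference of consecutive potentials.\<close>
  have 2: "- (D x \<bullet> \<gamma>) / s' \<le> - (D x \<bullet> \<gamma>) / s + d\<^sup>2 / (Q * s) * c\<^sup>2 / 4 + (Q / s - Q / s')"
  proof -
    have "D x \<bullet> \<gamma> \<le> d * c" unfolding c_def d_def by (rule norm_cauchy_schwarz)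
    then have "(D x \<bullet> \<gamma>) * (p / s) \<le> (d * c) * (p / s)"
      using p s by (intro mult_right_mono) auto
    moreover have "(d * c) * p \<le> d\<^sup>2 / Q * c\<^sup>2 / 4 + Q * p"
    proof -
      have "0 \<le> (d * c / 2 - Q * p)\<^sup>2 / Q" using Q by simp
      also have "\<dots> = d\<^sup>2 / Q * c\<^sup>2 / 4 - (d * c) * p + Q * p * p"
        using Q by (simp add: power2_eq_square field_simps)
      also have "Q * p * p \<le> Q * p" using p Q by (simp add: mult_left_le)
      finally show ?thesis by simp
    qed
    then have "(d * c) * p / s \<le> (d\<^sup>2 / Q * c\<^sup>2 / 4 + Q * p) / s"
      using s by (intro divide_right_mono) auto
    moreover have "(d\<^sup>2 / Q * c\<^sup>2 / 4 + Q * p) / s = d\<^sup>2 / (Q * s) * c\<^sup>2 / 4 + Q * (p / s)"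
      by (simp add: add_divide_distrib)
    ultimately have "(D x \<bullet> \<gamma>) * (p / s) \<le> d\<^sup>2 / (Q * s) * c\<^sup>2 / 4 + Q * (p / s)"
      by simp
    then show ?thesis unfolding ps by (simp add: right_diff_distrib)
  qed
  \<comment> \<open>The squared gradient grows along the step by a small multiple of itself and a large multiple of
    \<open>L\<^sup>2 \<alpha>\<^sup>2 p\<close>; the factor \<open>r\<close> makes the small multiple cost at most a quarter of \<open>\<parallel>D x\<parallel>\<^sup>2\<close>.\<close>
  have 3: "Q' / s' - Q / s' \<le> d\<^sup>2 / s / 4 + L\<^sup>2 * \<alpha>\<^sup>2 * \<sigma>0 * (5 + 4 * \<sigma>0) * (1 / s - 1 / s')"
  proof -
    define r where "r = 4 * (\<sigma>0 + 1)"
    define e where "e = norm (D x' - D x)"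
    have r: "r > 0" using \<sigma>0 by (simp add: r_def)
    have "norm (D x') \<le> d + e"
      unfolding d_def e_def by (metis add.commute diff_add_cancel norm_triangle_ineq)
    then have "(norm (D x'))\<^sup>2 \<le> (d + e)\<^sup>2" by (rule power_mono) simp
    also have "\<dots> \<le> d\<^sup>2 + d\<^sup>2 / r + (1 + r) * e\<^sup>2"
    proof -
      have "0 \<le> (d - r * e)\<^sup>2 / r" using r by simp
      also have "\<dots> = d\<^sup>2 / r - 2 * d * e + r * e\<^sup>2"
        using r by (simp add: power2_eq_square field_simps)
      finally show ?thesis by (simp add: power2_eq_square algebra_simps)
    qed
    finally have "\<sigma>0 * (norm (D x'))\<^sup>2 \<le> \<sigma>0 * (d\<^sup>2 + d\<^sup>2 / r + (1 + r) * e\<^sup>2)"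
      using \<sigma>0 by (intro mult_left_mono) auto
    then have "Q' - Q \<le> \<sigma>0 / r * d\<^sup>2 + \<sigma>0 * (1 + r) * e\<^sup>2"
      by (simp add: Q_def Q'_def d_def algebra_simps)
    also have "\<sigma>0 / r * d\<^sup>2 \<le> 1 / 4 * d\<^sup>2"
      using \<sigma>0 r by (intro mult_right_mono) (auto simp: r_def field_simps)
    also have "\<sigma>0 * (1 + r) * e\<^sup>2 \<le> \<sigma>0 * (1 + r) * (L\<^sup>2 * (\<alpha>\<^sup>2 * p))"
    proof -
      have "e\<^sup>2 \<le> (L * norm (x' - x))\<^sup>2"
        unfolding e_def using lip by (intro power_mono) auto
      then have "e\<^sup>2 \<le> L\<^sup>2 * (\<alpha>\<^sup>2 * p)" by (simp only: power_mult_distrib step2)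
      then show ?thesis using \<sigma>0 r by (intro mult_left_mono) auto
    qed
    finally have "(Q' - Q) / s' \<le> (1 / 4 * d\<^sup>2 + \<sigma>0 * (1 + r) * (L\<^sup>2 * (\<alpha>\<^sup>2 * p))) / s'"
      using s'pos by (intro divide_right_mono) auto
    also have "\<dots> \<le> (1 / 4 * d\<^sup>2 + \<sigma>0 * (1 + r) * (L\<^sup>2 * (\<alpha>\<^sup>2 * p))) / s"
      using s ss' \<sigma>0 r p by (intro divide_left_mono) auto
    also have "\<dots> = d\<^sup>2 / s / 4 + \<sigma>0 * (1 + r) * L\<^sup>2 * \<alpha>\<^sup>2 * (p / s)"
      by (simp add: add_divide_distrib)
    finally show ?thesis
      unfolding ps by (simp add: diff_divide_distrib r_def algebra_simps)
  qed
  have 4: "\<alpha> * (- (D x \<bullet> \<gamma>) / s' + Q' / s') \<le> \<alpha> * (- (D x \<bullet> \<gamma>) / s + d\<^sup>2 / (Q * s) * c\<^sup>2 / 4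
      + Q / s + d\<^sup>2 / s / 4 + L\<^sup>2 * \<alpha>\<^sup>2 * \<sigma>0 * (5 + 4 * \<sigma>0) * (1 / s - 1 / s'))"
    using 2 3 \<alpha> by (intro mult_left_mono) auto
  have W': "weighted_energy g D L \<alpha> \<sigma>0 \<sigma>1 x' s' =
      g x' / sqrt s' + L * \<alpha>\<^sup>2 * (1 / sqrt s') + \<alpha> * (Q' / s')
      + \<alpha> * (L\<^sup>2 * \<alpha>\<^sup>2 * \<sigma>0 * (5 + 4 * \<sigma>0) * (1 / s'))"
    by (simp add: weighted_energy_def Q'_def add_divide_distrib power3_eq_cube power2_eq_square algebra_simps)
  have W: "weighted_energy g D L \<alpha> \<sigma>0 \<sigma>1 x s =
      g x / sqrt s + L * \<alpha>\<^sup>2 * (1 / sqrt s) + \<alpha> * (Q / s)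
      + \<alpha> * (L\<^sup>2 * \<alpha>\<^sup>2 * \<sigma>0 * (5 + 4 * \<sigma>0) * (1 / s))"
    by (simp add: weighted_energy_def Q_def add_divide_distrib power3_eq_cube power2_eq_square algebra_simps)
  show ?thesis
    unfolding W W' Q_def[symmetric]
    unfolding d_def[symmetric] c_def[symmetric]
    using 1 4 by (simp add: algebra_simps)
qed

text \<open>Because of the hypothesis on flat points, the squared excess and its derivative both vanish when
  the squared gradient is below \<open>\<eta>\<close>; every error can therefore carry the indicator of the opposite
  case.\<close>
lemma log_excess_square_step:
  fixes g :: "'a::real_inner \<Rightarrow> real"
  assumes grad: "\<And>x. GDERIV g x :> D x"
    and lip: "\<And>x y. norm (D x - D y) \<le> L * norm (x - y)"
    and nonneg: "\<And>x. g x \<ge> 0" and L: "L > 0" and b: "b \<ge> 0"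
    and \<alpha>: "\<alpha> > 0" 
    and s: "s > 0" and s': "s' = s + (norm \<gamma>)\<^sup>2" and x': "x' = x - (\<alpha> / sqrt s') *\<^sub>R \<gamma>"
    and flat: "\<And>y. (norm (D x))\<^sup>2 < \<eta> \<Longrightarrow> norm (y - x) \<le> \<alpha> \<Longrightarrow> log_excess b (g y) = 0"
  shows "(log_excess b (g x'))\<^sup>2 \<le> (log_excess b (g x))\<^sup>2
    - \<alpha> * (2 * log_excess b (g x) / (1 + g x) / sqrt s * (D x \<bullet> \<gamma>))
    + (\<alpha> * (4 * sqrt (2 * L)) + 3 * L * \<alpha>\<^sup>2) * (of_bool ((norm (D x))\<^sup>2 \<ge> \<eta>) / s * (norm \<gamma>)\<^sup>2)"
proof -
  define c where "c = norm \<gamma>"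
  define w where "w = 2 * log_excess b (g x) / (1 + g x)"
  have s'pos: "s' > 0" and ss': "s \<le> s'" using s s' by (auto intro: add_pos_nonneg)
  have w: "w \<ge> 0" using nonneg[of x] by (simp add: w_def)
  have step: "norm (x' - x) = \<alpha> * (c / sqrt s')"
    using \<alpha> s'pos by (simp add: x' c_def)
  have c: "c \<le> sqrt s'" unfolding c_def s' using s by (intro real_le_rsqrt) auto
  show ?thesis
  proof (cases "(norm (D x))\<^sup>2 < \<eta>")
    case True
    have "norm (x' - x) \<le> \<alpha>"
      unfolding step using c \<alpha> s'pos by (intro mult_left_le) auto
    then show ?thesis
      using True flat[of x'] flat[of x] \<alpha> by simp
  next
    case False
    have "(log_excess b (g x'))\<^sup>2 \<le> (log_excess b (g x))\<^sup>2 + w * (D x \<bullet> (x' - x))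
        + 3 * L * (norm (x' - x))\<^sup>2"
      unfolding w_def by (rule log_excess_square_upper_bound[OF grad lip nonneg L b])
    also have "(norm (x' - x))\<^sup>2 \<le> \<alpha>\<^sup>2 * (c\<^sup>2 / s)"
      unfolding step using s ss' by (auto simp: power_mult_distrib power_divide intro!: divide_left_mono)
    also have "w * (D x \<bullet> (x' - x)) \<le> - (\<alpha> * (w / sqrt s * (D x \<bullet> \<gamma>))) + \<alpha> * (4 * sqrt (2 * L)) * (c\<^sup>2 / s)"
    proof -
      define k where "k = 1 / sqrt s - 1 / sqrt s'"
      have k: "k \<ge> 0" unfolding k_def using s ss' by (simp add: frac_le)
      have "w * (D x \<bullet> (x' - x)) = - (\<alpha> * (w / sqrt s * (D x \<bullet> \<gamma>))) + \<alpha> * w * (D x \<bullet> \<gamma>) * k"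
        by (simp add: x' k_def algebra_simps)
      also have "\<alpha> * w * (D x \<bullet> \<gamma>) * k \<le> \<alpha> * w * (norm (D x) * c) * k"
        using \<alpha> w k unfolding c_def by (intro mult_right_mono mult_left_mono norm_cauchy_schwarz) auto
      also have "\<dots> = \<alpha> * (w * norm (D x)) * (c * k)" by simp
      also have "\<dots> \<le> \<alpha> * (4 * sqrt (2 * L)) * (c\<^sup>2 / s)"
      proof (rule mult_mono)
        have "w * norm (D x) \<le> 4 * sqrt (2 * L)"
          unfolding w_def by (rule log_excess_square_gradient_bound[OF grad lip nonneg L b])
        then show "\<alpha> * (w * norm (D x)) \<le> \<alpha> * (4 * sqrt (2 * L))"
          using \<alpha> by (intro mult_left_mono) auto
        show "c * k \<le> c\<^sup>2 / s"
          using inverse_sqrt_decrement(2)[OF s, of "c\<^sup>2"] by (simp add: k_def s' c_def)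
      qed (use \<alpha> L w k in \<open>auto simp: c_def\<close>)
      finally show ?thesis by simp
    qed
    finally show ?thesis
      using False L by (simp add: w_def[symmetric] c_def[symmetric] algebra_simps)
  qed
qed

section \<open>AdaGrad-Norm as an adapted process\<close>

lemma integral_add_mult:
  fixes X Y :: "'w \<Rightarrow> real"
  assumes "integrable M X" "integrable M Y"
  shows integrable_add_mult: "integrable M (\<lambda>\<omega>. X \<omega> + a * Y \<omega>)"
    and "(\<integral>\<omega>. X \<omega> + a * Y \<omega> \<partial>M) = (\<integral>\<omega>. X \<omega> \<partial>M) + a * (\<integral>\<omega>. Y \<omega> \<partial>M)"
  using assms by simp_all

lemma integral_combination:
  fixes X Y Z :: "'w \<Rightarrow> real"
  assumes "integrable M X" "integrable M Y" "integrable M Z"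
  shows "integrable M (\<lambda>\<omega>. X \<omega> + a * Y \<omega> + c * Z \<omega>)"
    and "(\<integral>\<omega>. X \<omega> + a * Y \<omega> + c * Z \<omega> \<partial>M)
      = (\<integral>\<omega>. X \<omega> \<partial>M) + a * (\<integral>\<omega>. Y \<omega> \<partial>M) + c * (\<integral>\<omega>. Z \<omega> \<partial>M)"
  using assms by simp_all

text \<open>Time is counted from zero: \<open>x n\<close> and \<open>s n\<close> are known at time \<open>n\<close>, and \<open>\<gamma> n\<close> is the stochastic
  gradient drawn at \<open>x n\<close>, which becomes known at time \<open>n + 1\<close>.\<close>
locale adagrad_norm_process = prob_space M for M :: "'w measure" +
  fixes F :: "nat \<Rightarrow> 'w measure"
    and x \<gamma> :: "nat \<Rightarrow> 'w \<Rightarrow> 'a::euclidean_space" and s :: "nat \<Rightarrow> 'w \<Rightarrow> real"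
    and g :: "'a \<Rightarrow> real" and D :: "'a \<Rightarrow> 'a"
    and x0 :: 'a and s0 \<alpha> L \<sigma>0 \<sigma>1 :: real
  assumes subalg: "\<And>n. subalgebra M (F n)"
    and sets_F_Suc: "\<And>n. sets (F n) \<subseteq> sets (F (Suc n))"
    and x_adapted: "\<And>n. x n \<in> borel_measurable (F n)"
    and s_adapted: "\<And>n. s n \<in> borel_measurable (F n)"
    and \<gamma>_measurable [measurable]: "\<And>n. \<gamma> n \<in> borel_measurable M"
    and x_0: "\<And>\<omega>. \<omega> \<in> space M \<Longrightarrow> x 0 \<omega> = x0"
    and s_0: "\<And>\<omega>. \<omega> \<in> space M \<Longrightarrow> s 0 \<omega> = s0"
    and s_Suc: "\<And>n \<omega>. \<omega> \<in> space M \<Longrightarrow> s (Suc n) \<omega> = s n \<omega> + (norm (\<gamma> n \<omega>))\<^sup>2"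
    and x_Suc: "\<And>n \<omega>. \<omega> \<in> space M \<Longrightarrow>
      x (Suc n) \<omega> = x n \<omega> - (\<alpha> / sqrt (s (Suc n) \<omega>)) *\<^sub>R \<gamma> n \<omega>"
    and unbiased: "\<And>n i. i \<in> Basis \<Longrightarrow>
      AE \<omega> in M. real_cond_exp M (F n) (\<lambda>\<omega>. \<gamma> n \<omega> \<bullet> i) \<omega> = D (x n \<omega>) \<bullet> i"
    and second_moment: "\<And>n. AE \<omega> in M.
      nn_cond_exp M (F n) (\<lambda>\<omega>. ennreal ((norm (\<gamma> n \<omega>))\<^sup>2)) \<omega>
        \<le> ennreal (\<sigma>0 * (norm (D (x n \<omega>)))\<^sup>2 + \<sigma>1)"
    and grad: "\<And>z. GDERIV g z :> D z"
    and lip: "\<And>y z. norm (D y - D z) \<le> L * norm (y - z)"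
    and nonneg: "\<And>z. g z \<ge> 0"
    and L: "L > 0" and \<alpha>: "\<alpha> > 0" and s0: "s0 > 0"
    and \<sigma>0: "\<sigma>0 \<ge> 0" and \<sigma>1: "\<sigma>1 > 0"
begin

lemma measurable_x [measurable]: "x n \<in> borel_measurable M"
  by (rule measurable_from_subalg[OF subalg x_adapted])

lemma measurable_s [measurable]: "s n \<in> borel_measurable M"
  by (rule measurable_from_subalg[OF subalg s_adapted])

lemma space_F: "space (F n) = space M"
  using subalg[of n] by (simp add: subalgebra_def)

lemma subalgebra_F: "m \<le> n \<Longrightarrow> subalgebra (F n) (F m)"
  unfolding subalgebra_def using lift_Suc_mono_le[of "\<lambda>n. sets (F n)", OF sets_F_Suc]
  by (simp add: space_F)

lemma continuous_D: "continuous_on UNIV D"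
proof -
  have "L-lipschitz_on UNIV D"
    using lip L by (intro lipschitz_onI) (auto simp: dist_norm)
  then show ?thesis by (rule lipschitz_on_continuous_on)
qed

lemma continuous_g: "continuous_on UNIV g"
  using grad by (auto simp: gderiv_def intro!: continuous_at_imp_continuous_on has_derivative_continuous)

lemma measurable_D [measurable]: "D \<in> borel_measurable borel"
  by (rule borel_measurable_continuous_onI[OF continuous_D])

lemma measurable_g [measurable]: "g \<in> borel_measurable borel"
  by (rule borel_measurable_continuous_onI[OF continuous_g])

lemma s_ge: "\<omega> \<in> space M \<Longrightarrow> s0 \<le> s n \<omega>"
  by (induction n) (auto simp: s_0 s_Suc add_increasing2)

lemma s_pos: "\<omega> \<in> space M \<Longrightarrow> s n \<omega> > 0"
  using s_ge[of \<omega> n] s0 by simp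

text \<open>The squared norm of the stochastic gradient is one of the summands under the square root of the
  step size.\<close>
lemma norm_step_le:
  assumes "\<omega> \<in> space M"
  shows "norm (x (Suc n) \<omega> - x n \<omega>) \<le> \<alpha>"
proof -
  have "norm (\<gamma> n \<omega>) \<le> sqrt (s (Suc n) \<omega>)"
    using s_pos[OF assms, of n] by (intro real_le_rsqrt) (simp add: s_Suc assms)
  then have "\<alpha> * (norm (\<gamma> n \<omega>) / sqrt (s (Suc n) \<omega>)) \<le> \<alpha>"
    using \<alpha> s_pos[OF assms, of "Suc n"] by (intro mult_left_le) auto
  then show ?thesis using \<alpha> s_pos[OF assms, of "Suc n"] by (simp add: x_Suc assms)
qed

text \<open>This deterministic bound makes every continuous function of a single iterate bounded, and so
  reduces integrability to that of the squared stochastic gradient.\<close>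
lemma norm_x_le: "\<omega> \<in> space M \<Longrightarrow> norm (x n \<omega>) \<le> norm x0 + n * \<alpha>"
proof (induction n)
  case (Suc n)
  have "norm (x (Suc n) \<omega>) \<le> norm (x n \<omega>) + norm (x (Suc n) \<omega> - x n \<omega>)"
    by (metis add.commute diff_add_cancel norm_triangle_ineq)
  with Suc norm_step_le[of \<omega> n] show ?case by (simp add: algebra_simps)
qed (simp add: x_0)

lemma continuous_x_bounded:
  fixes f :: "'a \<Rightarrow> 'b::real_normed_vector"
  assumes "continuous_on UNIV f"
  obtains B where "B \<ge> 0" "\<And>\<omega>. \<omega> \<in> space M \<Longrightarrow> norm (f (x n \<omega>)) \<le> B"
proof -
  have "compact (f ` cball 0 (norm x0 + n * \<alpha>))"
    using assms by (intro compact_continuous_image) (auto intro: continuous_on_subset)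
  then obtain B where "\<forall>y\<in>f ` cball 0 (norm x0 + n * \<alpha>). norm y \<le> B"
    using compact_imp_bounded bounded_iff by metis
  then have "norm (f (x n \<omega>)) \<le> max 0 B" if "\<omega> \<in> space M" for \<omega>
    using norm_x_le[OF that, of n] by (force simp: dist_norm)
  then show ?thesis using that[of "max 0 B"] by auto
qed

lemma integrable_continuous_x_mult:
  fixes f :: "'a \<Rightarrow> real"
  assumes f: "continuous_on UNIV f" and k [measurable]: "k \<in> borel_measurable M"
    and K: "\<And>\<omega>. \<omega> \<in> space M \<Longrightarrow> \<bar>k \<omega>\<bar> \<le> K"
  shows "integrable M (\<lambda>\<omega>. k \<omega> * f (x n \<omega>))"
proof -
  have [measurable]: "f \<in> borel_measurable borel"
    by (rule borel_measurable_continuous_onI[OF f])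
  obtain B where B: "B \<ge> 0" "\<And>\<omega>. \<omega> \<in> space M \<Longrightarrow> norm (f (x n \<omega>)) \<le> B"
    by (rule continuous_x_bounded[OF f, of n]) blast
  show ?thesis
  proof (rule integrable_const_bound)
    show "AE \<omega> in M. norm (k \<omega> * f (x n \<omega>)) \<le> K * B"
      using K B by (auto simp: abs_mult intro!: AE_I2 mult_mono order_trans[OF abs_ge_zero K])
  qed measurable
qed

lemma nn_integral_second_moment:
  assumes h: "h \<in> borel_measurable (F n)" "\<And>\<omega>. \<omega> \<in> space M \<Longrightarrow> h \<omega> \<ge> 0"
  shows "(\<integral>\<^sup>+ \<omega>. ennreal (h \<omega> * (norm (\<gamma> n \<omega>))\<^sup>2) \<partial>M)
    \<le> (\<integral>\<^sup>+ \<omega>. ennreal (h \<omega> * (\<sigma>0 * (norm (D (x n \<omega>)))\<^sup>2 + \<sigma>1)) \<partial>M)"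
proof -
  interpret F: finite_measure_subalgebra M "F n"
    by unfold_locales (rule subalg)
  have "(\<integral>\<^sup>+ \<omega>. ennreal (h \<omega> * (norm (\<gamma> n \<omega>))\<^sup>2) \<partial>M)
      = (\<integral>\<^sup>+ \<omega>. ennreal (h \<omega>) * ennreal ((norm (\<gamma> n \<omega>))\<^sup>2) \<partial>M)"
    by (intro nn_integral_cong) (simp add: ennreal_mult h(2))
  also have "\<dots> = (\<integral>\<^sup>+ \<omega>. ennreal (h \<omega>) *
      nn_cond_exp M (F n) (\<lambda>\<omega>. ennreal ((norm (\<gamma> n \<omega>))\<^sup>2)) \<omega> \<partial>M)"
    using h(1) by (intro F.nn_cond_exp_intg[symmetric]) auto
  also have "\<dots> \<le> (\<integral>\<^sup>+ \<omega>. ennreal (h \<omega>) * ennreal (\<sigma>0 * (norm (D (x n \<omega>)))\<^sup>2 + \<sigma>1) \<partial>M)"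
    using second_moment[of n] by (intro nn_integral_mono_AE) (auto elim!: eventually_mono intro: mult_left_mono)
  also have "\<dots> = (\<integral>\<^sup>+ \<omega>. ennreal (h \<omega> * (\<sigma>0 * (norm (D (x n \<omega>)))\<^sup>2 + \<sigma>1)) \<partial>M)"
    using \<sigma>0 \<sigma>1 by (intro nn_integral_cong) (simp add: ennreal_mult h(2))
  finally show ?thesis .
qed

lemma continuous_moment_bound: "continuous_on UNIV (\<lambda>z. \<sigma>0 * (norm (D z))\<^sup>2 + \<sigma>1)"
  by (intro continuous_intros continuous_D)

lemma integrable_norm_square_\<gamma>: "integrable M (\<lambda>\<omega>. (norm (\<gamma> n \<omega>))\<^sup>2)"
proof (rule integrableI_bounded)
  have "integrable M (\<lambda>\<omega>. 1 * (\<sigma>0 * (norm (D (x n \<omega>)))\<^sup>2 + \<sigma>1))"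
    using integrable_continuous_x_mult[OF continuous_moment_bound, of "\<lambda>_. 1" 1] by simp
  then have "(\<integral>\<^sup>+ \<omega>. ennreal (1 * (\<sigma>0 * (norm (D (x n \<omega>)))\<^sup>2 + \<sigma>1)) \<partial>M) < \<infinity>"
    using \<sigma>0 \<sigma>1 by (subst nn_integral_eq_integral) auto
  then show "(\<integral>\<^sup>+ \<omega>. ennreal (norm ((norm (\<gamma> n \<omega>))\<^sup>2)) \<partial>M) < \<infinity>"
    using nn_integral_second_moment[of "\<lambda>_. 1" n] by (auto simp: le_less_trans)
qed measurable

lemma integrable_mult_norm_square_\<gamma>:
  assumes [measurable]: "h \<in> borel_measurable M" and H: "\<And>\<omega>. \<omega> \<in> space M \<Longrightarrow> \<bar>h \<omega>\<bar> \<le> H"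
  shows "integrable M (\<lambda>\<omega>. h \<omega> * (norm (\<gamma> n \<omega>))\<^sup>2)"
proof (rule Bochner_Integration.integrable_bound)
  show "integrable M (\<lambda>\<omega>. H * (norm (\<gamma> n \<omega>))\<^sup>2)"
    using integrable_norm_square_\<gamma> by simp
  show "AE \<omega> in M. norm (h \<omega> * (norm (\<gamma> n \<omega>))\<^sup>2) \<le> norm (H * (norm (\<gamma> n \<omega>))\<^sup>2)"
    using H by (auto simp: abs_mult intro!: AE_I2 mult_right_mono order_trans[OF H abs_ge_self])
qed measurable

lemma expectation_second_moment:
  assumes h: "h \<in> borel_measurable (F n)"
    and H: "\<And>\<omega>. \<omega> \<in> space M \<Longrightarrow> 0 \<le> h \<omega> \<and> h \<omega> \<le> H"
  shows "expectation (\<lambda>\<omega>. h \<omega> * (norm (\<gamma> n \<omega>))\<^sup>2)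
    \<le> expectation (\<lambda>\<omega>. h \<omega> * (\<sigma>0 * (norm (D (x n \<omega>)))\<^sup>2 + \<sigma>1))"
proof -
  have [measurable]: "h \<in> borel_measurable M" by (rule measurable_from_subalg[OF subalg h])
  have int: "integrable M (\<lambda>\<omega>. h \<omega> * (norm (\<gamma> n \<omega>))\<^sup>2)"
    using H by (intro integrable_mult_norm_square_\<gamma>[where H = H]) auto
  have int': "integrable M (\<lambda>\<omega>. h \<omega> * (\<sigma>0 * (norm (D (x n \<omega>)))\<^sup>2 + \<sigma>1))"
    using H by (intro integrable_continuous_x_mult[OF continuous_moment_bound, where K = H]) auto
  have pos: "AE \<omega> in M. 0 \<le> h \<omega> * (\<sigma>0 * (norm (D (x n \<omega>)))\<^sup>2 + \<sigma>1)"
    using H \<sigma>0 \<sigma>1 by (intro AE_I2 mult_nonneg_nonneg) auto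
  have pos': "AE \<omega> in M. 0 \<le> h \<omega> * (norm (\<gamma> n \<omega>))\<^sup>2"
    using H by (intro AE_I2 mult_nonneg_nonneg) auto
  show ?thesis
    using nn_integral_second_moment[OF h] H integral_nonneg_AE[OF pos]
    by (simp add: nn_integral_eq_integral[OF int pos'] nn_integral_eq_integral[OF int' pos] ennreal_le_iff)
qed

lemma expectation_inner_\<gamma>:
  assumes H: "H \<in> borel_measurable (F n)" and B: "\<And>\<omega>. \<omega> \<in> space M \<Longrightarrow> norm (H \<omega>) \<le> B"
  shows "integrable M (\<lambda>\<omega>. H \<omega> \<bullet> \<gamma> n \<omega>)" (is ?int)
    and "expectation (\<lambda>\<omega>. H \<omega> \<bullet> \<gamma> n \<omega>) = expectation (\<lambda>\<omega>. H \<omega> \<bullet> D (x n \<omega>))" (is ?eq)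
proof -
  interpret F: finite_measure_subalgebra M "F n"
    by unfold_locales (rule subalg)
  have [measurable]: "H \<in> borel_measurable M" by (rule measurable_from_subalg[OF subalg H])
  have int: "integrable M (\<lambda>\<omega>. (H \<omega> \<bullet> i) * (\<gamma> n \<omega> \<bullet> i))" if i: "i \<in> Basis" for i
  proof (rule Bochner_Integration.integrable_bound)
    show "integrable M (\<lambda>\<omega>. B * (1 + (norm (\<gamma> n \<omega>))\<^sup>2))"
      using integrable_norm_square_\<gamma>[of n] by simp
    show "AE \<omega> in M. norm ((H \<omega> \<bullet> i) * (\<gamma> n \<omega> \<bullet> i)) \<le> norm (B * (1 + (norm (\<gamma> n \<omega>))\<^sup>2))"
    proof (rule AE_I2)
      fix \<omega> assume \<omega>: "\<omega> \<in> space M"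
      have "\<bar>\<gamma> n \<omega> \<bullet> i\<bar> \<le> norm (\<gamma> n \<omega>)" by (rule Basis_le_norm[OF i])
      also have "\<dots> \<le> 1 + (norm (\<gamma> n \<omega>))\<^sup>2"
        using sum_squares_bound[of "norm (\<gamma> n \<omega>)" 1] norm_ge_zero[of "\<gamma> n \<omega>"]
        by (simp only: power_one mult_1_right)
      finally have "\<bar>H \<omega> \<bullet> i\<bar> * \<bar>\<gamma> n \<omega> \<bullet> i\<bar> \<le> B * (1 + (norm (\<gamma> n \<omega>))\<^sup>2)"
        using Basis_le_norm[OF i, of "H \<omega>"] B[OF \<omega>]
        by (intro mult_mono) (auto intro: order_trans[OF norm_ge_zero B[OF \<omega>]])
      then show "norm ((H \<omega> \<bullet> i) * (\<gamma> n \<omega> \<bullet> i)) \<le> norm (B * (1 + (norm (\<gamma> n \<omega>))\<^sup>2))"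
        using order_trans[OF norm_ge_zero B[OF \<omega>]] by (simp add: abs_mult)
    qed
  qed measurable
  then show ?int
    by (subst euclidean_inner) (intro Bochner_Integration.integrable_sum)
  have int': "integrable M (\<lambda>\<omega>. (H \<omega> \<bullet> i) * (D (x n \<omega>) \<bullet> i))" if i: "i \<in> Basis" for i
    using B Basis_le_norm[OF i]
    by (intro integrable_continuous_x_mult[where K = B and f = "\<lambda>z. D z \<bullet> i"])
      (auto intro!: continuous_intros continuous_D intro: order_trans)
  have eq: "expectation (\<lambda>\<omega>. (H \<omega> \<bullet> i) * (\<gamma> n \<omega> \<bullet> i)) = expectation (\<lambda>\<omega>. (H \<omega> \<bullet> i) * (D (x n \<omega>) \<bullet> i))"
    if i: "i \<in> Basis" for i
  proof -
    have "expectation (\<lambda>\<omega>. (H \<omega> \<bullet> i) * (\<gamma> n \<omega> \<bullet> i))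
        = expectation (\<lambda>\<omega>. (H \<omega> \<bullet> i) * real_cond_exp M (F n) (\<lambda>\<omega>. \<gamma> n \<omega> \<bullet> i) \<omega>)"
      using H by (intro F.real_cond_exp_intg(2)[symmetric] int i) auto
    also have "\<dots> = expectation (\<lambda>\<omega>. (H \<omega> \<bullet> i) * (D (x n \<omega>) \<bullet> i))"
      using unbiased[OF i, of n]
      by (intro integral_cong_AE) (auto elim!: eventually_mono)
    finally show ?thesis .
  qed
  have "expectation (\<lambda>\<omega>. H \<omega> \<bullet> \<gamma> n \<omega>) = expectation (\<lambda>\<omega>. \<Sum>i\<in>Basis. (H \<omega> \<bullet> i) * (\<gamma> n \<omega> \<bullet> i))"
    by (intro Bochner_Integration.integral_cong refl euclidean_inner)
  also have "\<dots> = (\<Sum>i\<in>Basis. expectation (\<lambda>\<omega>. (H \<omega> \<bullet> i) * (D (x n \<omega>) \<bullet> i)))"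
    by (simp add: Bochner_Integration.integral_sum int eq)
  also have "\<dots> = expectation (\<lambda>\<omega>. \<Sum>i\<in>Basis. (H \<omega> \<bullet> i) * (D (x n \<omega>) \<bullet> i))"
    by (simp add: Bochner_Integration.integral_sum int')
  also have "\<dots> = expectation (\<lambda>\<omega>. H \<omega> \<bullet> D (x n \<omega>))"
    by (intro Bochner_Integration.integral_cong refl euclidean_inner[symmetric])
  finally show ?eq .
qed

lemma integrable_weighted_energy:
  "integrable M (\<lambda>\<omega>. weighted_energy g D L \<alpha> \<sigma>0 \<sigma>1 (x n \<omega>) (s n \<omega>))"
proof -
  have "integrable M (\<lambda>\<omega>. 1 / sqrt (s n \<omega>) * (g (x n \<omega>) + L * \<alpha>\<^sup>2))"
    using s_pos s_ge s0
    by (intro integrable_continuous_x_mult[where K = "1 / sqrt s0" and f = "\<lambda>z. g z + L * \<alpha>\<^sup>2"])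
      (auto intro!: continuous_intros continuous_g divide_left_mono
        simp: less_imp_le)
  moreover have "integrable M (\<lambda>\<omega>. 1 / s n \<omega> *
      (\<alpha> * (\<sigma>0 * (norm (D (x n \<omega>)))\<^sup>2 + \<sigma>1) + \<alpha> ^ 3 * L\<^sup>2 * \<sigma>0 * (5 + 4 * \<sigma>0)))"
    using s_pos s_ge s0
    by (intro integrable_continuous_x_mult[where K = "1 / s0"
          and f = "\<lambda>z. \<alpha> * (\<sigma>0 * (norm (D z))\<^sup>2 + \<sigma>1) + \<alpha> ^ 3 * L\<^sup>2 * \<sigma>0 * (5 + 4 * \<sigma>0)"])
      (auto intro!: continuous_intros continuous_D divide_left_mono simp: less_imp_le)
  ultimately show ?thesis
    unfolding weighted_energy_def using Bochner_Integration.integrable_add by fastforce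
qed

lemma weighted_energy_nonneg:
  "\<omega> \<in> space M \<Longrightarrow> weighted_energy g D L \<alpha> \<sigma>0 \<sigma>1 (x n \<omega>) (s n \<omega>) \<ge> 0"
  using s_pos[of \<omega> n] nonneg L \<alpha> \<sigma>0 \<sigma>1
  by (auto simp: weighted_energy_def intro!: add_nonneg_nonneg mult_nonneg_nonneg divide_nonneg_pos)

lemma integrable_scaled_gradient: "integrable M (\<lambda>\<omega>. (norm (D (x n \<omega>)))\<^sup>2 / s n \<omega>)"
proof -
  have "integrable M (\<lambda>\<omega>. 1 / s n \<omega> * (norm (D (x n \<omega>)))\<^sup>2)"
    using s_pos s_ge s0
    by (intro integrable_continuous_x_mult[where K = "1 / s0" and f = "\<lambda>z. (norm (D z))\<^sup>2"])
      (auto intro!: continuous_intros continuous_D divide_left_mono simp: less_imp_le)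
  then show ?thesis by simp
qed

text \<open>Integration of \<open>weighted_energy_step\<close>: unbiasedness turns the inner product into
  \<open>\<parallel>D (x n)\<parallel>\<^sup>2 / s n\<close>, and the second-moment bound cancels the denominator \<open>Q\<close> of the quadratic term.\<close>
lemma expectation_weighted_energy_step:
  "expectation (\<lambda>\<omega>. weighted_energy g D L \<alpha> \<sigma>0 \<sigma>1 (x (Suc n) \<omega>) (s (Suc n) \<omega>))
    + \<alpha> / 2 * expectation (\<lambda>\<omega>. (norm (D (x n \<omega>)))\<^sup>2 / s n \<omega>)
   \<le> expectation (\<lambda>\<omega>. weighted_energy g D L \<alpha> \<sigma>0 \<sigma>1 (x n \<omega>) (s n \<omega>))"
proof -
  let ?W = "\<lambda>n \<omega>. weighted_energy g D L \<alpha> \<sigma>0 \<sigma>1 (x n \<omega>) (s n \<omega>)"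
  let ?H = "\<lambda>\<omega>. (1 / s n \<omega>) *\<^sub>R D (x n \<omega>)"
  let ?Q = "\<lambda>\<omega>. \<sigma>0 * (norm (D (x n \<omega>)))\<^sup>2 + \<sigma>1"
  let ?h = "\<lambda>\<omega>. (norm (D (x n \<omega>)))\<^sup>2 / (?Q \<omega> * s n \<omega>)"
  let ?z = "\<lambda>\<omega>. (norm (D (x n \<omega>)))\<^sup>2 / s n \<omega>"
  note [measurable] = x_adapted[of n] s_adapted[of n]
  have Q: "?Q \<omega> > 0" for \<omega> using \<sigma>0 \<sigma>1 by (simp add: add_nonneg_pos)
  obtain B where B: "B \<ge> 0" "\<And>\<omega>. \<omega> \<in> space M \<Longrightarrow> norm (D (x n \<omega>)) \<le> B"
    by (rule continuous_x_bounded[OF continuous_D, of n]) blast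
  have H_meas: "?H \<in> borel_measurable (F n)" by measurable
  have H_bound: "norm (?H \<omega>) \<le> B / s0" if "\<omega> \<in> space M" for \<omega>
    using B s_ge[OF that, of n] s_pos[OF that, of n] s0 that by (auto intro!: frac_le)
  have h_meas: "?h \<in> borel_measurable (F n)" by measurable
  have h_bound: "0 \<le> ?h \<omega> \<and> ?h \<omega> \<le> B\<^sup>2 / (\<sigma>1 * s0)" if "\<omega> \<in> space M" for \<omega>
    using B s_ge[OF that, of n] s_pos[OF that, of n] s0 Q[of \<omega>] \<sigma>0 \<sigma>1 that
    by (auto intro!: frac_le power_mono mult_mono)
  have h_abs: "\<bar>?h \<omega>\<bar> \<le> B\<^sup>2 / (\<sigma>1 * s0)" if "\<omega> \<in> space M" for \<omega>
    using h_bound[OF that] by linarith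
  have int_h: "integrable M (\<lambda>\<omega>. ?h \<omega> * (norm (\<gamma> n \<omega>))\<^sup>2)"
    by (rule integrable_mult_norm_square_\<gamma>[OF measurable_from_subalg[OF subalg h_meas] h_abs])
  have int_H: "integrable M (\<lambda>\<omega>. ?H \<omega> \<bullet> \<gamma> n \<omega>)"
    by (rule expectation_inner_\<gamma>(1)[OF H_meas H_bound])
  have H_eq: "expectation (\<lambda>\<omega>. ?H \<omega> \<bullet> \<gamma> n \<omega>) = expectation ?z"
    by (subst expectation_inner_\<gamma>(2)[OF H_meas H_bound]) (simp_all add: dot_square_norm)
  have h_le: "expectation (\<lambda>\<omega>. ?h \<omega> * (norm (\<gamma> n \<omega>))\<^sup>2) \<le> expectation ?z"
    using expectation_second_moment[OF h_meas h_bound] Q by (simp add: less_imp_neq[OF Q, symmetric])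
  have "expectation (\<lambda>\<omega>. ?W (Suc n) \<omega> + \<alpha> * (?H \<omega> \<bullet> \<gamma> n \<omega>))
      \<le> expectation (\<lambda>\<omega>. ?W n \<omega> + \<alpha> / 4 * (?h \<omega> * (norm (\<gamma> n \<omega>))\<^sup>2) + \<alpha> / 4 * ?z \<omega>)"
  proof (rule integral_mono_AE)
    show "AE \<omega> in M. ?W (Suc n) \<omega> + \<alpha> * (?H \<omega> \<bullet> \<gamma> n \<omega>)
        \<le> ?W n \<omega> + \<alpha> / 4 * (?h \<omega> * (norm (\<gamma> n \<omega>))\<^sup>2) + \<alpha> / 4 * ?z \<omega>"
    proof (rule AE_I2)
      fix \<omega> assume \<omega>: "\<omega> \<in> space M"
      show "?W (Suc n) \<omega> + \<alpha> * (?H \<omega> \<bullet> \<gamma> n \<omega>)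
          \<le> ?W n \<omega> + \<alpha> / 4 * (?h \<omega> * (norm (\<gamma> n \<omega>))\<^sup>2) + \<alpha> / 4 * ?z \<omega>"
        using weighted_energy_step[OF grad lip nonneg L \<alpha> \<sigma>0 \<sigma>1 s_pos[OF \<omega>] s_Suc[OF \<omega>] x_Suc[OF \<omega>]]
        by simp
    qed
  qed (rule integrable_add_mult[OF integrable_weighted_energy int_H],
      rule integral_combination(1)[OF integrable_weighted_energy int_h integrable_scaled_gradient])
  also have "\<dots> = expectation (?W n) + \<alpha> / 4 * expectation (\<lambda>\<omega>. ?h \<omega> * (norm (\<gamma> n \<omega>))\<^sup>2)
      + \<alpha> / 4 * expectation ?z"
    by (rule integral_combination(2)[OF integrable_weighted_energy int_h integrable_scaled_gradient])
  also have "\<dots> \<le> expectation (?W n) + \<alpha> / 4 * expectation ?z + \<alpha> / 4 * expectation ?z"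
    using \<alpha> by (intro add_right_mono add_left_mono mult_left_mono h_le) auto
  also have "expectation (\<lambda>\<omega>. ?W (Suc n) \<omega> + \<alpha> * (?H \<omega> \<bullet> \<gamma> n \<omega>))
      = expectation (?W (Suc n)) + \<alpha> * expectation (\<lambda>\<omega>. ?H \<omega> \<bullet> \<gamma> n \<omega>)"
    by (rule integral_add_mult(2)[OF integrable_weighted_energy int_H])
  finally show ?thesis unfolding H_eq by simp
qed

lemma sum_expectation_scaled_gradient_le:
  "(\<Sum>k<n. expectation (\<lambda>\<omega>. (norm (D (x k \<omega>)))\<^sup>2 / s k \<omega>))
    \<le> 2 / \<alpha> * weighted_energy g D L \<alpha> \<sigma>0 \<sigma>1 x0 s0"
proof -
  let ?W = "\<lambda>n. expectation (\<lambda>\<omega>. weighted_energy g D L \<alpha> \<sigma>0 \<sigma>1 (x n \<omega>) (s n \<omega>))"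
  let ?z = "\<lambda>n. expectation (\<lambda>\<omega>. (norm (D (x n \<omega>)))\<^sup>2 / s n \<omega>)"
  have "?W n + \<alpha> / 2 * (\<Sum>k<n. ?z k) \<le> ?W 0"
  proof (induction n)
    case (Suc n)
    with expectation_weighted_energy_step[of n] show ?case by (simp add: distrib_left)
  qed simp
  moreover have "?W 0 = weighted_energy g D L \<alpha> \<sigma>0 \<sigma>1 x0 s0"
    by (subst Bochner_Integration.integral_cong[OF refl, of _ _ "\<lambda>_. weighted_energy g D L \<alpha> \<sigma>0 \<sigma>1 x0 s0"])
      (simp_all add: x_0 s_0 prob_space)
  moreover have "?W n \<ge> 0"
    by (intro integral_nonneg_AE AE_I2 weighted_energy_nonneg)
  ultimately show ?thesis using \<alpha> by (simp add: field_simps)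
qed

section \<open>The excess of the logarithm as an almost supermartingale\<close>

context
  fixes b \<eta> :: real
  assumes b: "b \<ge> 0" and \<eta>: "\<eta> > 0"
    and flat: "\<And>y z. (norm (D z))\<^sup>2 < \<eta> \<Longrightarrow> norm (y - z) \<le> \<alpha> \<Longrightarrow> log_excess b (g y) = 0"
begin

text \<open>Where the squared gradient is at least \<open>\<eta>\<close>, the constant \<open>\<sigma>1\<close> is at most \<open>\<sigma>1 / \<eta>\<close> times it.\<close>
lemma sum_expectation_large_gradient_le:
  "(\<Sum>k<n. expectation (\<lambda>\<omega>. of_bool ((norm (D (x k \<omega>)))\<^sup>2 \<ge> \<eta>) / s k \<omega> * (norm (\<gamma> k \<omega>))\<^sup>2))
    \<le> (\<sigma>0 + \<sigma>1 / \<eta>) * (2 / \<alpha> * weighted_energy g D L \<alpha> \<sigma>0 \<sigma>1 x0 s0)"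
proof -
  let ?h = "\<lambda>k \<omega>. of_bool ((norm (D (x k \<omega>)))\<^sup>2 \<ge> \<eta>) / s k \<omega>"
  let ?z = "\<lambda>k \<omega>. (norm (D (x k \<omega>)))\<^sup>2 / s k \<omega>"
  have step: "expectation (\<lambda>\<omega>. ?h k \<omega> * (norm (\<gamma> k \<omega>))\<^sup>2) \<le> (\<sigma>0 + \<sigma>1 / \<eta>) * expectation (?z k)" for k
  proof -
    note [measurable] = x_adapted[of k] s_adapted[of k]
    have h_meas: "?h k \<in> borel_measurable (F k)" by measurable
    have h_bound: "0 \<le> ?h k \<omega> \<and> ?h k \<omega> \<le> 1 / s0" if "\<omega> \<in> space M" for \<omega>
      using s_ge[OF that, of k] s_pos[OF that, of k] s0 by (auto intro!: frac_le)
    have "expectation (\<lambda>\<omega>. ?h k \<omega> * (norm (\<gamma> k \<omega>))\<^sup>2)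
        \<le> expectation (\<lambda>\<omega>. ?h k \<omega> * (\<sigma>0 * (norm (D (x k \<omega>)))\<^sup>2 + \<sigma>1))"
      by (rule expectation_second_moment[OF h_meas h_bound])
    also have "\<dots> \<le> expectation (\<lambda>\<omega>. (\<sigma>0 + \<sigma>1 / \<eta>) * ?z k \<omega>)"
    proof (rule integral_mono_AE)
      have "\<bar>?h k \<omega>\<bar> \<le> 1 / s0" if "\<omega> \<in> space M" for \<omega>
        using h_bound[OF that] by linarith
      then show "integrable M (\<lambda>\<omega>. ?h k \<omega> * (\<sigma>0 * (norm (D (x k \<omega>)))\<^sup>2 + \<sigma>1))"
        by (rule integrable_continuous_x_mult[OF continuous_moment_bound
              measurable_from_subalg[OF subalg h_meas]])
      show "AE \<omega> in M. ?h k \<omega> * (\<sigma>0 * (norm (D (x k \<omega>)))\<^sup>2 + \<sigma>1) \<le> (\<sigma>0 + \<sigma>1 / \<eta>) * ?z k \<omega>"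
      proof (rule AE_I2)
        fix \<omega> assume \<omega>: "\<omega> \<in> space M"
        define d where "d = (norm (D (x k \<omega>)))\<^sup>2"
        have "of_bool (d \<ge> \<eta>) * (\<sigma>0 * d + \<sigma>1) \<le> (\<sigma>0 + \<sigma>1 / \<eta>) * d"
        proof (cases "d \<ge> \<eta>")
          case True
          then have "\<sigma>1 * 1 \<le> \<sigma>1 * (d / \<eta>)" using \<eta> \<sigma>1 by (intro mult_left_mono) auto
          then show ?thesis using True by (simp add: algebra_simps)
        next
          case False
          then show ?thesis using \<sigma>0 \<sigma>1 \<eta> by (simp add: d_def)
        qed
        then have "of_bool (d \<ge> \<eta>) * (\<sigma>0 * d + \<sigma>1) / s k \<omega> \<le> (\<sigma>0 + \<sigma>1 / \<eta>) * d / s k \<omega>"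
          using s_pos[OF \<omega>, of k] by (intro divide_right_mono) auto
        then show "?h k \<omega> * (\<sigma>0 * (norm (D (x k \<omega>)))\<^sup>2 + \<sigma>1) \<le> (\<sigma>0 + \<sigma>1 / \<eta>) * ?z k \<omega>"
          by (simp add: d_def)
      qed
    qed (intro integrable_mult_right integrable_scaled_gradient)
    also have "\<dots> = (\<sigma>0 + \<sigma>1 / \<eta>) * expectation (?z k)"
      by (rule Bochner_Integration.integral_mult_right_zero)
    finally show ?thesis .
  qed
  have "(\<Sum>k<n. expectation (\<lambda>\<omega>. ?h k \<omega> * (norm (\<gamma> k \<omega>))\<^sup>2))
      \<le> (\<Sum>k<n. (\<sigma>0 + \<sigma>1 / \<eta>) * expectation (?z k))"
    by (intro sum_mono step)
  also have "\<dots> = (\<sigma>0 + \<sigma>1 / \<eta>) * (\<Sum>k<n. expectation (?z k))"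
    by (simp add: sum_distrib_left)
  also have "\<dots> \<le> (\<sigma>0 + \<sigma>1 / \<eta>) * (2 / \<alpha> * weighted_energy g D L \<alpha> \<sigma>0 \<sigma>1 x0 s0)"
    using \<sigma>0 \<sigma>1 \<eta> by (intro mult_left_mono sum_expectation_scaled_gradient_le) auto
  finally show ?thesis .
qed

text \<open>The squared excess stopped when it first reaches the level \<open>c\<close>, and truncated to \<open>c\<close> from then on.
  The truncation keeps it bounded, and can only lower it.\<close>
definition stopped_excess :: "real \<Rightarrow> nat \<Rightarrow> 'w \<Rightarrow> real" where
  "stopped_excess c n \<omega> =
     (if \<forall>k\<le>n. (log_excess b (g (x k \<omega>)))\<^sup>2 < c then (log_excess b (g (x n \<omega>)))\<^sup>2 else c)"

lemma measurable_log_excess [measurable]: "log_excess b \<in> borel_measurable borel"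
  unfolding log_excess_def by measurable

lemma stopped_excess_measurable [measurable]: "stopped_excess c n \<in> borel_measurable M"
  unfolding stopped_excess_def by measurable

lemma integrable_stopped_excess:
  assumes "c > 0"
  shows "integrable M (stopped_excess c n)"
proof (rule integrable_const_bound)
  show "AE \<omega> in M. norm (stopped_excess c n \<omega>) \<le> c"
    using assms by (intro AE_I2) (auto simp: stopped_excess_def less_imp_le)
qed measurable

abbreviation noise_coefficient :: real where
  "noise_coefficient \<equiv> \<alpha> * (4 * sqrt (2 * L)) + 3 * L * \<alpha>\<^sup>2"

text \<open>The event that the level has not been reached is known before the stochastic gradient is drawn, so
  it may multiply the first-order term without spoiling its sign in expectation.\<close>
lemma expectation_stopped_excess_step:
  assumes c: "c > 0"
  shows "expectation (stopped_excess c (Suc n)) \<le> expectation (stopped_excess c n)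
    + noise_coefficient *
      expectation (\<lambda>\<omega>. of_bool ((norm (D (x n \<omega>)))\<^sup>2 \<ge> \<eta>) / s n \<omega> * (norm (\<gamma> n \<omega>))\<^sup>2)"
proof -
  let ?V = "\<lambda>k \<omega>. (log_excess b (g (x k \<omega>)))\<^sup>2"
  let ?A = "\<lambda>\<omega>. of_bool (\<forall>k\<le>n. ?V k \<omega> < c) :: real"
  let ?w = "\<lambda>\<omega>. 2 * log_excess b (g (x n \<omega>)) / (1 + g (x n \<omega>))"
  let ?H = "\<lambda>\<omega>. (?A \<omega> * (?w \<omega> / sqrt (s n \<omega>))) *\<^sub>R D (x n \<omega>)"
  let ?h = "\<lambda>\<omega>. of_bool ((norm (D (x n \<omega>)))\<^sup>2 \<ge> \<eta>) / s n \<omega>"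
  have C: "noise_coefficient \<ge> 0" using \<alpha> L by simp
  have adapted [measurable]: "x k \<in> borel_measurable (F n)" if "k \<le> n" for k
    by (rule measurable_from_subalg[OF subalgebra_F[OF that] x_adapted])
  note [measurable] = x_adapted[of n] s_adapted[of n]
  have A_meas [measurable]: "?A \<in> borel_measurable (F n)"
  proof -
    have "Measurable.pred (F n) (\<lambda>\<omega>. \<forall>k\<in>{..n}. ?V k \<omega> < c)"
      by (intro pred_intros_finite) (auto intro!: borel_measurable_less measurable_compose[OF adapted])
    then show ?thesis by (simp add: Ball_def)
  qed
  have H_meas: "?H \<in> borel_measurable (F n)" by measurable
  have w_nonneg: "?w \<omega> \<ge> 0" for \<omega> using nonneg[of "x n \<omega>"] by simp
  have H_bound: "norm (?H \<omega>) \<le> 4 * sqrt (2 * L) * (1 / sqrt s0)" if "\<omega> \<in> space M" for \<omega>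
  proof -
    have "norm (?H \<omega>) = ?A \<omega> * ((?w \<omega> * norm (D (x n \<omega>))) * (1 / sqrt (s n \<omega>)))"
      using w_nonneg[of \<omega>] s_pos[OF that, of n] nonneg[of "x n \<omega>"] by simp
    also have "\<dots> \<le> (?w \<omega> * norm (D (x n \<omega>))) * (1 / sqrt (s n \<omega>))"
      using w_nonneg[of \<omega>] s_pos[OF that, of n]
      by (intro mult_left_le_one_le mult_nonneg_nonneg) auto
    also have "\<dots> \<le> (4 * sqrt (2 * L)) * (1 / sqrt s0)"
      using log_excess_square_gradient_bound[OF grad lip nonneg L b, of "x n \<omega>"] w_nonneg[of \<omega>]
        s_pos[OF that, of n] s_ge[OF that, of n] s0 L
      by - (rule mult_mono, auto intro!: frac_le)
    finally show ?thesis .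
  qed
  have h_abs: "\<bar>?h \<omega>\<bar> \<le> 1 / s0" if "\<omega> \<in> space M" for \<omega>
    using s_ge[OF that, of n] s_pos[OF that, of n] s0 by (auto intro!: frac_le)
  have h_meas: "?h \<in> borel_measurable M" by measurable
  have int_h: "integrable M (\<lambda>\<omega>. ?h \<omega> * (norm (\<gamma> n \<omega>))\<^sup>2)"
    by (rule integrable_mult_norm_square_\<gamma>[OF h_meas h_abs])
  have int_H: "integrable M (\<lambda>\<omega>. ?H \<omega> \<bullet> \<gamma> n \<omega>)"
    by (rule expectation_inner_\<gamma>(1)[OF H_meas H_bound])
  have H_eq: "expectation (\<lambda>\<omega>. ?H \<omega> \<bullet> \<gamma> n \<omega>) = expectation (\<lambda>\<omega>. ?H \<omega> \<bullet> D (x n \<omega>))"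
    by (rule expectation_inner_\<gamma>(2)[OF H_meas H_bound])
  note int_U = integrable_stopped_excess[OF c]
  have "expectation (stopped_excess c (Suc n))
      \<le> expectation (\<lambda>\<omega>. stopped_excess c n \<omega> + (- \<alpha>) * (?H \<omega> \<bullet> \<gamma> n \<omega>)
          + noise_coefficient * (?h \<omega> * (norm (\<gamma> n \<omega>))\<^sup>2))"
  proof (rule integral_mono_AE)
    show "AE \<omega> in M. stopped_excess c (Suc n) \<omega> \<le> stopped_excess c n \<omega> + (- \<alpha>) * (?H \<omega> \<bullet> \<gamma> n \<omega>)
          + noise_coefficient * (?h \<omega> * (norm (\<gamma> n \<omega>))\<^sup>2)"
    proof (rule AE_I2)
      fix \<omega> assume \<omega>: "\<omega> \<in> space M"
      have hn: "noise_coefficient * (?h \<omega> * (norm (\<gamma> n \<omega>))\<^sup>2) \<ge> 0"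
        using C s_pos[OF \<omega>, of n] by (intro mult_nonneg_nonneg) auto
      show "stopped_excess c (Suc n) \<omega> \<le> stopped_excess c n \<omega> + (- \<alpha>) * (?H \<omega> \<bullet> \<gamma> n \<omega>)
          + noise_coefficient * (?h \<omega> * (norm (\<gamma> n \<omega>))\<^sup>2)"
      proof (cases "\<forall>k\<le>n. ?V k \<omega> < c")
        case True
        have "stopped_excess c (Suc n) \<omega> \<le> ?V (Suc n) \<omega>"
          using True by (auto simp: stopped_excess_def le_Suc_eq not_less)
        also have "\<dots> \<le> ?V n \<omega> - \<alpha> * (?w \<omega> / sqrt (s n \<omega>) * (D (x n \<omega>) \<bullet> \<gamma> n \<omega>))
            + noise_coefficient * (?h \<omega> * (norm (\<gamma> n \<omega>))\<^sup>2)"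
          by (rule log_excess_square_step[OF grad lip nonneg L b \<alpha> s_pos[OF \<omega>] s_Suc[OF \<omega>] x_Suc[OF \<omega>] flat])
        also have "?w \<omega> / sqrt (s n \<omega>) * (D (x n \<omega>) \<bullet> \<gamma> n \<omega>) = ?H \<omega> \<bullet> \<gamma> n \<omega>"
          using True by simp
        also have "?V n \<omega> = stopped_excess c n \<omega>"
          using True by (simp add: stopped_excess_def)
        finally show ?thesis by simp
      next
        case False
        then have "?A \<omega> = 0" by simp
        then have "?H \<omega> \<bullet> \<gamma> n \<omega> = 0"
          by (simp only: mult_zero_left scaleR_zero_left inner_zero_left)
        moreover have "stopped_excess c (Suc n) \<omega> = stopped_excess c n \<omega>"
          using False by (auto simp: stopped_excess_def le_Suc_eq)
        ultimately show ?thesis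
          using hn by (simp only: mult_zero_right add_0_right le_add_same_cancel1)
      qed
    qed
  qed (rule int_U, rule integral_combination(1)[OF int_U int_H int_h])
  also have "\<dots> = expectation (stopped_excess c n) + (- \<alpha>) * expectation (\<lambda>\<omega>. ?H \<omega> \<bullet> \<gamma> n \<omega>)
      + noise_coefficient * expectation (\<lambda>\<omega>. ?h \<omega> * (norm (\<gamma> n \<omega>))\<^sup>2)"
    by (rule integral_combination(2)[OF int_U int_H int_h])
  also have "expectation (\<lambda>\<omega>. ?H \<omega> \<bullet> \<gamma> n \<omega>) \<ge> 0"
    unfolding H_eq
    using w_nonneg s_pos
    by (intro integral_nonneg_AE AE_I2) (simp add: nonneg add_nonneg_nonneg less_imp_le)
  then have "expectation (stopped_excess c n) + (- \<alpha>) * expectation (\<lambda>\<omega>. ?H \<omega> \<bullet> \<gamma> n \<omega>)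
      + noise_coefficient * expectation (\<lambda>\<omega>. ?h \<omega> * (norm (\<gamma> n \<omega>))\<^sup>2)
      \<le> expectation (stopped_excess c n)
      + noise_coefficient * expectation (\<lambda>\<omega>. ?h \<omega> * (norm (\<gamma> n \<omega>))\<^sup>2)"
    using \<alpha> by simp
  finally show ?thesis .
qed

definition excess_budget :: real where
  "excess_budget = (log_excess b (g x0))\<^sup>2 + noise_coefficient *
     ((\<sigma>0 + \<sigma>1 / \<eta>) * (2 / \<alpha> * weighted_energy g D L \<alpha> \<sigma>0 \<sigma>1 x0 s0))"

lemma expectation_stopped_excess_le:
  assumes c: "c > 0"
  shows "expectation (stopped_excess c n) \<le> excess_budget"
proof -
  let ?e = "\<lambda>k. expectation (\<lambda>\<omega>. of_bool ((norm (D (x k \<omega>)))\<^sup>2 \<ge> \<eta>) / s k \<omega> * (norm (\<gamma> k \<omega>))\<^sup>2)"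
  have "expectation (stopped_excess c 0) \<le> expectation (\<lambda>_. (log_excess b (g x0))\<^sup>2)"
    using integrable_stopped_excess[OF c]
    by (intro integral_mono_AE AE_I2) (auto simp: stopped_excess_def x_0)
  then have "expectation (stopped_excess c 0) \<le> (log_excess b (g x0))\<^sup>2"
    by (simp add: prob_space)
  then have "expectation (stopped_excess c n) \<le> (log_excess b (g x0))\<^sup>2 + noise_coefficient * (\<Sum>k<n. ?e k)"
  proof (induction n)
    case (Suc n)
    with expectation_stopped_excess_step[OF c, of n] show ?case by (simp add: distrib_left)
  qed simp
  also have "\<dots> \<le> excess_budget"
    unfolding excess_budget_def using \<alpha> L
    by (intro add_left_mono mult_left_mono sum_expectation_large_gradient_le) auto
  finally show ?thesis .
qed

text \<open>The stopped excess equals \<open>c\<close> once the level has been reached, so Markov's inequality applies to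
  each finite horizon; continuity of the measure removes the horizon.\<close>
lemma maximal_inequality:
  assumes c: "c > 0"
  shows "prob {\<omega> \<in> space M. \<exists>k. (log_excess b (g (x k \<omega>)))\<^sup>2 \<ge> c} \<le> excess_budget / c"
proof -
  let ?E = "\<lambda>n. {\<omega> \<in> space M. \<exists>k\<le>n. (log_excess b (g (x k \<omega>)))\<^sup>2 \<ge> c}"
  have E_meas [measurable]: "?E n \<in> events" for n by measurable
  have "prob (?E n) \<le> excess_budget / c" for n
  proof -
    have "expectation (\<lambda>\<omega>. c * indicator (?E n) \<omega>) \<le> expectation (stopped_excess c n)"
    proof (rule integral_mono_AE)
      show "AE \<omega> in M. c * indicator (?E n) \<omega> \<le> stopped_excess c n \<omega>"
        using c by (intro AE_I2) (auto simp: stopped_excess_def indicator_def not_less)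
    qed (auto intro!: integrable_stopped_excess c integrable_mult_right integrable_real_indicator
        simp: less_top[symmetric])
    then have "c * prob (?E n) \<le> excess_budget"
      using expectation_stopped_excess_le[OF c, of n] by simp
    then show ?thesis using c by (simp add: field_simps)
  qed
  moreover have "(\<lambda>n. prob (?E n)) \<longlonglongrightarrow> prob (\<Union>n. ?E n)"
    by (rule finite_Lim_measure_incseq) (auto simp: incseq_def intro: order_trans)
  ultimately have "prob (\<Union>n. ?E n) \<le> excess_budget / c"
    by (intro LIMSEQ_le_const2) auto
  also have "(\<Union>n. ?E n) = {\<omega> \<in> space M. \<exists>k. (log_excess b (g (x k \<omega>)))\<^sup>2 \<ge> c}" by auto
  finally show ?thesis .
qed

lemma AE_log_excess_bounded: "AE \<omega> in M. \<exists>m::nat. \<forall>k. (log_excess b (g (x k \<omega>)))\<^sup>2 < m"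
proof -
  let ?N = "{\<omega> \<in> space M. \<not> (\<exists>m::nat. \<forall>k. (log_excess b (g (x k \<omega>)))\<^sup>2 < m)}"
  have N_meas [measurable]: "?N \<in> events" by measurable
  have "prob ?N \<le> excess_budget / Suc m" for m
  proof -
    have "prob ?N \<le> prob {\<omega> \<in> space M. \<exists>k. (log_excess b (g (x k \<omega>)))\<^sup>2 \<ge> Suc m}"
      by (intro finite_measure_mono) (auto simp: not_less simp del: of_nat_Suc)
    also have "\<dots> \<le> excess_budget / Suc m" by (rule maximal_inequality) simp
    finally show ?thesis .
  qed
  moreover have "(\<lambda>m. excess_budget / Suc m) \<longlonglongrightarrow> 0"
    by (rule LIMSEQ_Suc[OF lim_const_over_n])
  ultimately have "prob ?N \<le> 0"
    by (intro LIMSEQ_le_const) auto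
  then have "?N \<in> null_sets M"
    by (intro null_setsI) (auto simp: emeasure_eq_measure measure_le_0_iff)
  then show ?thesis by (rule AE_I'[of ?N]) auto
qed

end

theorem AE_bounded:
  assumes \<eta>: "\<eta> > 0" and far: "\<And>z. norm z > R \<Longrightarrow> (norm (D z))\<^sup>2 \<ge> \<eta>"
    and coercive: "filterlim g at_top at_infinity"
  shows "AE \<omega> in M. \<exists>B. \<forall>n. norm (x n \<omega>) \<le> B"
proof -
  have "compact (g ` cball 0 (R + \<alpha>))"
    using continuous_g by (intro compact_continuous_image) (auto intro: continuous_on_subset)
  then obtain a where "\<forall>v\<in>g ` cball 0 (R + \<alpha>). norm v \<le> a"
    using compact_imp_bounded bounded_iff by metis
  then have a: "g y \<le> a" if "norm y \<le> R + \<alpha>" for y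
    using that by (simp add: abs_le_iff)
  \<comment> \<open>The ball of radius \<open>R + \<alpha>\<close> contains every point within one step of a point where the squared
    gradient is below \<open>\<eta>\<close>; \<open>max 0\<close> covers the case that it is empty.\<close>
  define b where "b = ln (1 + max 0 a)"
  have b: "b \<ge> 0" by (simp add: b_def)
  have flat: "log_excess b (g y) = 0" if "(norm (D z))\<^sup>2 < \<eta>" "norm (y - z) \<le> \<alpha>" for y z
  proof -
    have "norm z \<le> R" using far[of z] that(1) by force
    then have "norm y \<le> R + \<alpha>"
      using that(2) norm_triangle_sub[of y z] by linarith
    then have "ln (1 + g y) \<le> b"
      unfolding b_def using a[of y] nonneg[of y] by (subst ln_le_cancel_iff) auto
    then show ?thesis by (simp add: log_excess_def)
  qed
  have "AE \<omega> in M. \<exists>m::nat. \<forall>k. (log_excess b (g (x k \<omega>)))\<^sup>2 < m"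
    by (rule AE_log_excess_bounded[OF b \<eta> flat])
  then show ?thesis
  proof (rule eventually_mono)
    fix \<omega> assume "\<exists>m::nat. \<forall>k. (log_excess b (g (x k \<omega>)))\<^sup>2 < m"
    then obtain m :: nat where m: "\<And>k. (log_excess b (g (x k \<omega>)))\<^sup>2 < m" by blast
    have "g (x k \<omega>) < exp (b + sqrt m)" for k
    proof -
      have "log_excess b (g (x k \<omega>)) < sqrt m" using m[of k] by (rule real_less_rsqrt)
      then have "ln (1 + g (x k \<omega>)) < b + sqrt m" by (simp add: log_excess_def)
      then have "exp (ln (1 + g (x k \<omega>))) < exp (b + sqrt m)" by simp
      then show ?thesis using nonneg[of "x k \<omega>"] by simp
    qed
    moreover obtain B where "\<And>z. norm z \<ge> B \<Longrightarrow> g z \<ge> exp (b + sqrt m)"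
      using coercive unfolding filterlim_at_top eventually_at_infinity by meson
    ultimately have "norm (x k \<omega>) \<le> B" for k
      by (meson linorder_le_cases not_le)
    then show "\<exists>B. \<forall>n. norm (x n \<omega>) \<le> B" by blast
  qed
qed

end

section \<open>The filtration of the algorithm\<close>

lemma space_adagrad_filtration: "space (adagrad_filtration M N \<theta> \<xi> n) = space M"
  by (simp add: adagrad_filtration_def space_measure_of_conv)

lemma sets_adagrad_filtration_Suc:
  "sets (adagrad_filtration M N \<theta> \<xi> (Suc n)) = sigma_sets (space M)
        ({\<theta> 1 -` A \<inter> space M | A. A \<in> sets borel} \<union>
         (\<Union>i\<in>{1..Suc n}. {\<xi> i -` A \<inter> space M | A. A \<in> sets N}))"
  unfolding adagrad_filtration_def by (auto intro!: sets_measure_of)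

text \<open>The step from time zero needs a separate argument, as the first sigma-algebra is trivial by
  definition and not generated by the initial point.\<close>
lemma sets_adagrad_filtration_mono:
  "sets (adagrad_filtration M N \<theta> \<xi> n) \<subseteq> sets (adagrad_filtration M N \<theta> \<xi> (Suc n))"
proof (cases n)
  case 0
  have "sets (adagrad_filtration M N \<theta> \<xi> 0) = {{}, space M}"
    by (simp add: adagrad_filtration_def sigma_sets_empty_eq)
  then show ?thesis
    using 0 sets.top[of "adagrad_filtration M N \<theta> \<xi> (Suc 0)"] by (simp add: space_adagrad_filtration)
next
  case (Suc m)
  show ?thesis
    unfolding Suc sets_adagrad_filtration_Suc
    by (intro sigma_sets_subseteq Un_mono UN_mono) auto
qed

lemma measurable_\<xi>_adagrad_filtration:
  assumes \<xi>: "\<xi> (Suc n) \<in> M \<rightarrow>\<^sub>M N"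
  shows "\<xi> (Suc n) \<in> adagrad_filtration M N \<theta> \<xi> (Suc n) \<rightarrow>\<^sub>M N"
proof (rule measurableI)
  fix A assume A: "A \<in> sets N"
  then show "\<xi> (Suc n) -` A \<inter> space (adagrad_filtration M N \<theta> \<xi> (Suc n))
      \<in> sets (adagrad_filtration M N \<theta> \<xi> (Suc n))"
    unfolding space_adagrad_filtration sets_adagrad_filtration_Suc
    by (intro sigma_sets.Basic UnI2 UN_I[of "Suc n"]) auto
qed (use measurable_space[OF \<xi>] in \<open>auto simp: space_adagrad_filtration\<close>)

theorem corollary3p2:
  fixes M :: "'w measure" and N :: "'x measure"
    and g :: "real ^ 'd \<Rightarrow> real" and grad_g :: "real ^ 'd \<Rightarrow> real ^ 'd"
    and G :: "real ^ 'd \<Rightarrow> 'x \<Rightarrow> real ^ 'd"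
    and \<xi> :: "nat \<Rightarrow> 'w \<Rightarrow> 'x"
    and \<theta> :: "nat \<Rightarrow> 'w \<Rightarrow> real ^ 'd" and S :: "nat \<Rightarrow> 'w \<Rightarrow> real"
    and x1 :: "real ^ 'd"
    and S0 \<alpha>0 L \<eta> \<sigma>0 \<sigma>1 D0 D1 :: real
  assumes prob: "prob_space M"
    and noise_indep: "prob_space.indep_vars M (\<lambda>_. N) \<xi> {1..}"
    and oracle_measurable: "(\<lambda>(x, z). G x z) \<in> borel \<Otimes>\<^sub>M N \<rightarrow>\<^sub>M borel"
    and S0_pos: "S0 > 0" and \<alpha>0_pos: "\<alpha>0 > 0"
    and adagrad: "adagrad_norm M G \<xi> x1 S0 \<alpha>0 \<theta> S"
    and g_i_gradient: "\<And>x. GDERIV g x :> grad_g x"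
    and g_i_continuous: "continuous_on UNIV grad_g"
    and g_i_nonneg: "\<And>x. g x \<ge> 0"
    and g_ii: "\<And>x y. norm (grad_g x - grad_g y) \<le> L * norm (x - y)"
    and \<eta>_pos: "\<eta> > 0"
    and g_iii: "Liminf at_infinity (\<lambda>x. ereal ((norm (grad_g x))\<^sup>2)) > ereal \<eta>"
    and g_iv: "filterlim g at_top at_infinity"
    and n_i: "\<And>n. n \<ge> 1 \<Longrightarrow>
          is_vec_cond_exp M (adagrad_filtration M N \<theta> \<xi> (n - 1))
            (\<lambda>\<omega>. G (\<theta> n \<omega>) (\<xi> n \<omega>)) (\<lambda>\<omega>. grad_g (\<theta> n \<omega>))"
    and \<sigma>0_nonneg: "\<sigma>0 \<ge> 0" and \<sigma>1_nonneg: "\<sigma>1 \<ge> 0"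
    and n_ii: "\<And>n. n \<ge> 1 \<Longrightarrow>
          AE \<omega> in M. nn_cond_exp M (adagrad_filtration M N \<theta> \<xi> (n - 1))
              (\<lambda>\<omega>. ennreal ((norm (G (\<theta> n \<omega>) (\<xi> n \<omega>)))\<^sup>2)) \<omega>
            \<le> ennreal (\<sigma>0 * (norm (grad_g (\<theta> n \<omega>)))\<^sup>2 + \<sigma>1)"
    and D0_pos: "D0 > 0" and D1_pos: "D1 > 0"
    and n_iii: "\<And>n. n \<ge> 1 \<Longrightarrow>
          AE \<omega> in M. (norm (grad_g (\<theta> n \<omega>)))\<^sup>2 < D0 \<longrightarrow>
            (norm (G (\<theta> n \<omega>) (\<xi> n \<omega>)))\<^sup>2 < D1"
  shows "AE \<omega> in M. (SUP n\<in>{1..}. ereal (norm (\<theta> n \<omega>))) < \<infinity>"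
proof -
  interpret P: prob_space M by (rule prob)
  define F where "F = adagrad_filtration M N \<theta> \<xi>"
  define \<gamma> where "\<gamma> n \<omega> = G (\<theta> (Suc n) \<omega>) (\<xi> (Suc n) \<omega>)" for n \<omega>
  have \<theta>_1: "\<theta> 1 \<omega> = x1" and S_0: "S 0 \<omega> = S0" if "\<omega> \<in> space M" for \<omega>
    using adagrad that by (auto simp: adagrad_norm_def)
  have S_Suc: "S (Suc n) \<omega> = S n \<omega> + (norm (\<gamma> n \<omega>))\<^sup>2"
    and \<theta>_Suc: "\<theta> (Suc (Suc n)) \<omega> = \<theta> (Suc n) \<omega> - (\<alpha>0 / sqrt (S (Suc n) \<omega>)) *\<^sub>R \<gamma> n \<omega>"
    if "\<omega> \<in> space M" for n \<omega>
  proof -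
    have "\<forall>n\<ge>1. S n \<omega> = S (n - 1) \<omega> + (norm (G (\<theta> n \<omega>) (\<xi> n \<omega>)))\<^sup>2 \<and>
        \<theta> (n + 1) \<omega> = \<theta> n \<omega> - (\<alpha>0 / sqrt (S n \<omega>)) *\<^sub>R G (\<theta> n \<omega>) (\<xi> n \<omega>)"
      using adagrad that unfolding adagrad_norm_def by blast
    from spec[OF this, of "Suc n"]
    show "S (Suc n) \<omega> = S n \<omega> + (norm (\<gamma> n \<omega>))\<^sup>2"
      and "\<theta> (Suc (Suc n)) \<omega> = \<theta> (Suc n) \<omega> - (\<alpha>0 / sqrt (S (Suc n) \<omega>)) *\<^sub>R \<gamma> n \<omega>"
      by (simp_all add: \<gamma>_def)
  qed
  have \<xi>_meas: "\<xi> i \<in> M \<rightarrow>\<^sub>M N" if "i \<ge> 1" for i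
    using noise_indep that by (simp add: P.indep_vars_def2)
  have \<theta>_1_meas: "\<theta> 1 \<in> borel_measurable M"
    by (subst measurable_cong[OF \<theta>_1]) auto
  have subalg: "subalgebra M (F n)" for n
    unfolding F_def by (intro subalgebra_adagrad_filtration \<xi>_meas \<theta>_1_meas)
  have space_F: "space (F n) = space M" for n
    by (simp add: F_def space_adagrad_filtration)
  have F_mono: "sets (F n) \<subseteq> sets (F (Suc n))" for n
    unfolding F_def by (rule sets_adagrad_filtration_mono)
  have sub_Suc: "subalgebra (F (Suc n)) (F n)" for n
    using F_mono by (simp add: subalgebra_def space_F)
  have \<xi>_adapted: "\<xi> (Suc n) \<in> F (Suc n) \<rightarrow>\<^sub>M N" for n
    unfolding F_def by (intro measurable_\<xi>_adagrad_filtration \<xi>_meas) simp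
  have \<gamma>_adapted: "\<gamma> n \<in> borel_measurable (F (Suc n))" if "\<theta> (Suc n) \<in> borel_measurable (F n)" for n
  proof -
    have "(\<lambda>\<omega>. (\<theta> (Suc n) \<omega>, \<xi> (Suc n) \<omega>)) \<in> F (Suc n) \<rightarrow>\<^sub>M borel \<Otimes>\<^sub>M N"
      using measurable_from_subalg[OF sub_Suc that] \<xi>_adapted by (rule measurable_Pair)
    from measurable_compose[OF this oracle_measurable] show ?thesis
      by (simp add: \<gamma>_def[abs_def])
  qed
  have adapted: "\<theta> (Suc n) \<in> borel_measurable (F n) \<and> S n \<in> borel_measurable (F n)" for n
  proof (induction n)
    case 0
    have "\<theta> (Suc 0) \<in> borel_measurable (F 0)"
      by (subst measurable_cong[of _ _ "\<lambda>_. x1"]) (auto simp: space_F \<theta>_1[simplified])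
    moreover have "S 0 \<in> borel_measurable (F 0)"
      by (subst measurable_cong[of _ _ "\<lambda>_. S0"]) (auto simp: space_F S_0)
    ultimately show ?case by simp
  next
    case (Suc n)
    note [measurable] = \<gamma>_adapted[OF conjunct1[OF Suc]]
      measurable_from_subalg[OF sub_Suc conjunct1[OF Suc]]
      measurable_from_subalg[OF sub_Suc conjunct2[OF Suc]]
    have S [measurable]: "S (Suc n) \<in> borel_measurable (F (Suc n))"
      by (subst measurable_cong[OF S_Suc]) (auto simp: space_F)
    have "\<theta> (Suc (Suc n)) \<in> borel_measurable (F (Suc n))"
      by (subst measurable_cong[OF \<theta>_Suc]) (auto simp: space_F)
    with S show ?case by simp
  qed
  \<comment> \<open>The iterates are indexed from one, hence the shift. Positive values of the Lipschitz constant and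
    of the additive moment constant are obtained by enlarging \<open>L\<close> and \<open>\<sigma>1\<close>.\<close>
  have process: "adagrad_norm_process M F (\<lambda>n. \<theta> (Suc n)) \<gamma> S g grad_g x1 S0 \<alpha>0 (max L 1) \<sigma>0 (\<sigma>1 + 1)"
  proof unfold_locales
    show "\<gamma> n \<in> borel_measurable M" for n
      using adapted by (intro measurable_from_subalg[OF subalg \<gamma>_adapted]) auto
    show "AE \<omega> in M. real_cond_exp M (F n) (\<lambda>\<omega>. \<gamma> n \<omega> \<bullet> i) \<omega> = grad_g (\<theta> (Suc n) \<omega>) \<bullet> i"
      if i: "i \<in> Basis" for n i
    proof -
      from i obtain j where "i = axis j 1" by (auto simp: Basis_vec_def)
      then show ?thesis
        using n_i[of "Suc n"] by (simp add: is_vec_cond_exp_def inner_axis \<gamma>_def F_def)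
    qed
    show "AE \<omega> in M. nn_cond_exp M (F n) (\<lambda>\<omega>. ennreal ((norm (\<gamma> n \<omega>))\<^sup>2)) \<omega>
        \<le> ennreal (\<sigma>0 * (norm (grad_g (\<theta> (Suc n) \<omega>)))\<^sup>2 + (\<sigma>1 + 1))" for n
    proof -
      have "AE \<omega> in M. nn_cond_exp M (F n) (\<lambda>\<omega>. ennreal ((norm (\<gamma> n \<omega>))\<^sup>2)) \<omega>
          \<le> ennreal (\<sigma>0 * (norm (grad_g (\<theta> (Suc n) \<omega>)))\<^sup>2 + \<sigma>1)"
        using n_ii[of "Suc n"] by (simp add: \<gamma>_def F_def)
      then show ?thesis
        by (rule eventually_mono) (erule order_trans, simp add: ennreal_leI)
    qed
    show "norm (grad_g y - grad_g z) \<le> max L 1 * norm (y - z)" for y z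
      by (rule order_trans[OF g_ii]) (simp add: mult_right_mono)
  qed (use subalg F_mono adapted \<theta>_1 S_0 S_Suc \<theta>_Suc g_i_gradient g_i_nonneg S0_pos \<alpha>0_pos
      \<sigma>0_nonneg \<sigma>1_nonneg in auto)
  interpret adagrad_norm_process M F "\<lambda>n. \<theta> (Suc n)" \<gamma> S g grad_g x1 S0 \<alpha>0 "max L 1" \<sigma>0 "\<sigma>1 + 1"
    by (rule process)
  have "\<forall>\<^sub>F z in at_infinity. ereal \<eta> < ereal ((norm (grad_g z))\<^sup>2)"
    using g_iii by (rule less_LiminfD)
  then obtain R where R: "\<And>z. norm z \<ge> R \<Longrightarrow> \<eta> < (norm (grad_g z))\<^sup>2"
    by (auto simp: eventually_at_infinity)
  have "AE \<omega> in M. \<exists>B. \<forall>n. norm (\<theta> (Suc n) \<omega>) \<le> B"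
    by (rule AE_bounded[OF \<eta>_pos _ g_iv, of R]) (use R in \<open>simp add: less_imp_le\<close>)
  then show ?thesis
  proof (rule eventually_mono)
    fix \<omega> assume "\<exists>B. \<forall>n. norm (\<theta> (Suc n) \<omega>) \<le> B"
    then obtain B where B: "\<And>n. norm (\<theta> (Suc n) \<omega>) \<le> B" by blast
    have "(SUP n\<in>{1..}. ereal (norm (\<theta> n \<omega>))) \<le> ereal B"
    proof (rule SUP_least)
      fix n :: nat assume "n \<in> {1..}"
      then show "ereal (norm (\<theta> n \<omega>)) \<le> ereal B" using B[of "n - 1"] by simp
    qed
    then show "(SUP n\<in>{1..}. ereal (norm (\<theta> n \<omega>))) < \<infinity>"
      using le_less_trans by fastforce
  qed
qed

end
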